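(* Let $n\ge p$ be positive integers, let $\bar X\in\mathbb{R}^{n\times p}$ with $r:=\operatorname{rank}\bar X$, let $\bar X=\bar U\operatorname{diag}(\sigma(\bar X))\bar V^T$ be a singular value decomposition with $\bar U\in O(n)$, $\bar V\in O(p)$, let $\mathbb{E}$ be a finite-dimensional Euclidean space and let $\mathcal{A}:\mathbb{R}^{n\times p}\to\mathbb{E}$ be linear. Set $$W(\bar X):=\left\{\bar U M\begin{pmatrix}I_r&0\\0&R\end{pmatrix}\bar V^T\ :\ M\in\mathbb{S}^n_+-\mathcal{S}^r_{++},\ \operatorname{tr}(M)=0,\ R\in\mathcal{V}_{n-r,p-r},\ M\begin{pmatrix}I_r&0\\0&RR^T\end{pmatrix}=M\right\}.$$ Then the following are equivalent: (i) The set $\mathcal{X}:=\{X\in\mathbb{R}^{n\times p}:\mathcal{A}(X)=\mathcal{A}(\bar X),\ \|X\|_*=\|\bar X\|_*\}$ does not contain a proper line segment including $\bar X$ (i.e. a line segment that contains $\bar X$ and is not just $\{\bar X\}$). (ii) $\ker\mathcal{A}\cap W(\bar X)=\{0\}$.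
   Context: $\|\cdot\|_*$ is the nuclear norm (sum of singular values). $\sigma(\bar X)\in\mathbb{R}^p$ is the vector of singular values in nonincreasing order and $\operatorname{diag}(\sigma(\bar X))$ is the $n\times p$ rectangular diagonal matrix with these diagonal entries. $O(k)$ is the set of orthogonal $k\times k$ matrices; $\mathbb{S}^n_+$ the positive semidefinite symmetric $n\times n$ matrices; $\mathbb{S}^r_{++}$ the positive definite symmetric $r\times r$ matrices. $\mathcal{S}^r_{++}:=\left\{\begin{pmatrix}A&0\\0&0\end{pmatrix}\in\mathbb{S}^n_+: A\in\mathbb{S}^r_{++}\right\}$, and $\mathbb{S}^n_+-\mathcal{S}^r_{++}=\{P-S:P\in\mathbb{S}^n_+,S\in\mathcal{S}^r_{++}\}$. $\mathcal{V}_{m,q}=\{R\in\mathbb{R}^{m\times q}:R^TR=I_q\}$ is the Stiefel manifold. Blocks with zero rows or columns are void: if $r=p$ then $\mathcal{V}_{n-r,0}$ consists of the empty matrix and $RR^T=0\in\mathbb{R}^{(n-r)\times(n-r)}$; if $r=0$ then $\mathcal{S}^0_{++}=\{0\}$. *)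

theory Defs
  imports "Jordan_Normal_Form.Char_Poly" "Jordan_Normal_Form.DL_Rank"
    "HOL-Analysis.Inner_Product"
begin

(* Dimensions are natural numbers here because the block sizes depend on the rank of a matrix,
   so matrices are those of Jordan_Normal_Form, restricted to carrier_mat. *)

definition stiefel :: "nat \<Rightarrow> nat \<Rightarrow> real mat set" where
  "stiefel m q = {R \<in> carrier_mat m q. transpose_mat R * R = 1\<^sub>m q}"

(* orthogonal_mat of Jordan_Normal_Form only asks for the columns to be pairwise orthogonal
   and nonzero, not for unit length, so it cannot be used for O(k). *)
definition orth_group :: "nat \<Rightarrow> real mat set" where
  "orth_group k = {U \<in> carrier_mat k k. transpose_mat U * U = 1\<^sub>m k \<and> U * transpose_mat U = 1\<^sub>m k}"

definition psd_mats :: "nat \<Rightarrow> real mat set" where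
  "psd_mats n = {P \<in> carrier_mat n n. transpose_mat P = P \<and>
     (\<forall>v \<in> carrier_vec n. scalar_prod v (P *\<^sub>v v) \<ge> 0)}"

definition pd_mats :: "nat \<Rightarrow> real mat set" where
  "pd_mats r = {A \<in> carrier_mat r r. transpose_mat A = A \<and>
     (\<forall>v \<in> carrier_vec r. v \<noteq> 0\<^sub>v r \<longrightarrow> scalar_prod v (A *\<^sub>v v) > 0)}"

definition block_pd_mats :: "nat \<Rightarrow> nat \<Rightarrow> real mat set" where
  "block_pd_mats n r =
     {four_block_mat A (0\<^sub>m r (n - r)) (0\<^sub>m (n - r) r) (0\<^sub>m (n - r) (n - r)) | A. A \<in> pd_mats r}
     \<inter> psd_mats n"

definition mat_trace :: "real mat \<Rightarrow> real" where
  "mat_trace M = sum_list (diag_mat M)"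

(* Square roots of the eigenvalues of X^T X, counted with multiplicity, in nonincreasing order.
   The symmetric matrix X^T X has only real eigenvalues, so there are dim_col X entries; this is
   the usual vector of singular values when dim_col X \<le> dim_row X. *)
definition singular_values :: "real mat \<Rightarrow> real list" where
  "singular_values X =
     rev (sorted_list_of_multiset (image_mset sqrt (proots (char_poly (transpose_mat X * X)))))"

definition nuclear_norm :: "real mat \<Rightarrow> real" where
  "nuclear_norm X = sum_list (singular_values X)"

definition rect_diag :: "nat \<Rightarrow> nat \<Rightarrow> real list \<Rightarrow> real mat" where
  "rect_diag n p s = mat n p (\<lambda>(i, j). if i = j then s ! i else 0)"

definition mat_rank :: "real mat \<Rightarrow> nat" where
  "mat_rank X = vec_space.rank (dim_row X) X"

(* The type real mat contains matrices of all sizes and is no vector space, so linearity and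
   segments are spelled out on carrier_mat n p. *)

definition linear_on_mats :: "nat \<Rightarrow> nat \<Rightarrow> (real mat \<Rightarrow> 'e::real_vector) \<Rightarrow> bool" where
  "linear_on_mats n p \<A> \<longleftrightarrow>
     (\<forall>X \<in> carrier_mat n p. \<forall>Y \<in> carrier_mat n p. \<A> (X + Y) = \<A> X + \<A> Y) \<and>
     (\<forall>c. \<forall>X \<in> carrier_mat n p. \<A> (c \<cdot>\<^sub>m X) = c *\<^sub>R \<A> X)"

definition mat_kernel_on :: "nat \<Rightarrow> nat \<Rightarrow> (real mat \<Rightarrow> 'e::real_vector) \<Rightarrow> real mat set" where
  "mat_kernel_on n p \<A> = {X \<in> carrier_mat n p. \<A> X = 0}"

definition mat_segment :: "real mat \<Rightarrow> real mat \<Rightarrow> real mat set" where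
  "mat_segment P Q = {(1 - t) \<cdot>\<^sub>m P + t \<cdot>\<^sub>m Q | t. 0 \<le> t \<and> t \<le> 1}"

definition contains_proper_segment_at :: "nat \<Rightarrow> nat \<Rightarrow> real mat set \<Rightarrow> real mat \<Rightarrow> bool" where
  "contains_proper_segment_at n p C X \<longleftrightarrow>
     (\<exists>P \<in> carrier_mat n p. \<exists>Q \<in> carrier_mat n p.
        mat_segment P Q \<subseteq> C \<and> X \<in> mat_segment P Q \<and> mat_segment P Q \<noteq> {X})"

definition level_set :: "nat \<Rightarrow> nat \<Rightarrow> (real mat \<Rightarrow> 'e) \<Rightarrow> real mat \<Rightarrow> real mat set" where
  "level_set n p \<A> X0 =
     {X \<in> carrier_mat n p. \<A> X = \<A> X0 \<and> nuclear_norm X = nuclear_norm X0}"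

definition block_id :: "nat \<Rightarrow> real mat \<Rightarrow> real mat" where
  "block_id r B = four_block_mat (1\<^sub>m r) (0\<^sub>m r (dim_col B)) (0\<^sub>m (dim_row B) r) B"

definition W_set :: "nat \<Rightarrow> nat \<Rightarrow> nat \<Rightarrow> real mat \<Rightarrow> real mat \<Rightarrow> real mat set" where
  "W_set n p r U V =
     {U * M * block_id r R * transpose_mat V | M R.
        (\<exists>P \<in> psd_mats n. \<exists>S \<in> block_pd_mats n r. M = P - S) \<and>
        mat_trace M = 0 \<and>
        R \<in> stiefel (n - r) (p - r) \<and>
        M * block_id r (R * transpose_mat R) = M}"

end

theory Submission
  imports Defs
begin

text \<open>
  The nuclear norm is affine between \<open>X\<close> and \<open>Y\<close> exactly when both have a common polar factor:
  \<open>X = Q T\<close> and \<open>Y = Q T'\<close> with \<open>Q\<close> having orthonormal columns and \<open>T, T'\<close> positive semidefinite.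
  Indeed the midpoint \<open>Z\<close> has a polar decomposition \<open>Z = Q K\<close>, so \<open>\<langle>Q, Z\<rangle> = \<parallel>Z\<parallel>\<close>, while
  \<open>\<langle>Q, G T\<rangle> \<le> tr T\<close> holds because \<open>\<parallel>(Q - G) S\<parallel>\<^sup>2 \<ge> 0\<close> in the Frobenius norm for \<open>S\<close> the square root
  of \<open>T\<close>, and equality forces \<open>Q T = G T\<close>.  In singular coordinates of \<open>X\<close>, \<open>Q diag(\<sigma>) = diag(\<sigma>)\<close> makes
  \<open>Q\<close> block diagonal with blocks \<open>I\<close> and \<open>R\<close>, and \<open>Y - X = (Q T' Q\<^sup>T - diag(\<sigma>)) Q\<close> is an element of the set
  \<open>W\<close>.  Conversely, for \<open>M = P - S\<close> the matrix \<open>diag(\<sigma>) + t M\<close> stays positive semidefinite for small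
  \<open>t \<ge> 0\<close>, so the nuclear norm along \<open>M Q\<close> is the trace of that matrix, which is constant.
\<close>

section \<open>Matrix algebra with dimension side conditions\<close>

text \<open>Unlike their \<open>carrier_mat\<close> versions, these rules have no extra variables in their premises, so
  the simplifier can use them.\<close>

lemma mult_assoc_dim:
  fixes A B C :: "real mat"
  assumes "dim_col A = dim_row B" "dim_col B = dim_row C"
  shows "A * B * C = A * (B * C)"
  by (rule assoc_mult_mat[of _ "dim_row A" "dim_col A" _ "dim_col B" _ "dim_col C"]) (use assms in auto)

lemma mult_minus_distrib_dim:
  fixes A B C :: "real mat"
  assumes "dim_col A = dim_row B" "dim_row B = dim_row C" "dim_col B = dim_col C"
  shows "A * (B - C) = A * B - A * C"
  by (rule mult_minus_distrib_mat[of _ "dim_row A" "dim_col A" _ "dim_col B"]) (use assms in auto)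

lemma minus_mult_distrib_dim:
  fixes A B C :: "real mat"
  assumes "dim_col A = dim_row C" "dim_row A = dim_row B" "dim_col A = dim_col B"
  shows "(A - B) * C = A * C - B * C"
  by (rule minus_mult_distrib_mat[of _ "dim_row A" "dim_col A" _ _ "dim_col C"]) (use assms in auto)

lemma add_mult_distrib_dim:
  fixes A B C :: "real mat"
  assumes "dim_col A = dim_row C" "dim_row A = dim_row B" "dim_col A = dim_col B"
  shows "(A + B) * C = A * C + B * C"
  by (rule add_mult_distrib_mat[of _ "dim_row A" "dim_col A" _ _ "dim_col C"]) (use assms in auto)

lemma mult_add_distrib_dim:
  fixes A B C :: "real mat"
  assumes "dim_col A = dim_row B" "dim_row B = dim_row C" "dim_col B = dim_col C"
  shows "A * (B + C) = A * B + A * C"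
  by (rule mult_add_distrib_mat[of _ "dim_row A" "dim_col A" _ "dim_col B"]) (use assms in auto)

lemma smult_mult_dim:
  fixes A B :: "real mat"
  assumes "dim_col A = dim_row B"
  shows "(c \<cdot>\<^sub>m A) * B = c \<cdot>\<^sub>m (A * B)" "A * (c \<cdot>\<^sub>m B) = c \<cdot>\<^sub>m (A * B)"
  by (rule mult_smult_assoc_mat[of _ "dim_row A" "dim_col A" _ "dim_col B"], use assms in auto)

lemma transpose_mult_dim:
  fixes A B :: "real mat"
  assumes "dim_col A = dim_row B"
  shows "transpose_mat (A * B) = transpose_mat B * transpose_mat A"
  by (rule transpose_mult[of _ "dim_row A" "dim_col A" _ "dim_col B"]) (use assms in auto)

lemma transpose_minus_dim:
  fixes A B :: "real mat"
  assumes "dim_row A = dim_row B" "dim_col A = dim_col B"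
  shows "transpose_mat (A - B) = transpose_mat A - transpose_mat B"
  by (rule transpose_minus[of _ "dim_row A" "dim_col A"]) (use assms in auto)

section \<open>Orthonormal families and the spectral theorem\<close>

text \<open>Indexed by an arbitrary set rather than an initial segment, because in
  \<open>polar_decomposition\<close> unit vectors are available at first only at the indices of
  nonzero eigenvalues.\<close>

definition orthonormal :: "nat \<Rightarrow> (nat \<Rightarrow> real vec) \<Rightarrow> nat set \<Rightarrow> bool" where
  "orthonormal n f I \<longleftrightarrow> (\<forall>i\<in>I. f i \<in> carrier_vec n) \<and>
     (\<forall>i\<in>I. \<forall>j\<in>I. scalar_prod (f i) (f j) = (if i = j then 1 else 0))"

text \<open>Take the given vectors as rows of a square matrix and fill up with zero rows. Having
  fewer than \<open>n\<close> vectors makes the last row zero, so the determinant vanishes; a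
  nonzero kernel vector is then normalized.\<close>

lemma exists_orthogonal_unit:
  fixes f :: "nat \<Rightarrow> real vec"
  assumes "finite I" "card I < n" "\<forall>i\<in>I. f i \<in> carrier_vec n"
  shows "\<exists>v\<in>carrier_vec n. scalar_prod v v = 1 \<and> (\<forall>i\<in>I. scalar_prod (f i) v = 0)"
proof -
  obtain xs where xs: "set xs = I" "length xs = card I"
    using assms(1) finite_distinct_list distinct_card by metis
  define A where "A = mat n n (\<lambda>(i, j). if i < card I then f (xs ! i) $ j else 0)"
  have A: "A \<in> carrier_mat n n" by (simp add: A_def)
  have "transpose_mat A *\<^sub>v unit_vec n (n - 1) = 0\<^sub>v n"
    using assms(2) by (intro eq_vecI) (auto simp: A_def)
  moreover have "unit_vec n (n - 1) \<noteq> (0\<^sub>v n :: real vec)"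
    using assms(2) by (metis index_unit_vec(2) index_zero_vec(1) diff_less gr_zeroI
        less_numeral_extra(1) not_less0 unit_vec_nonzero)
  ultimately have "det (transpose_mat A) = 0"
    using det_0_iff_vec_prod_zero_field[of "transpose_mat A" n] A by (metis transpose_carrier_mat unit_vec_carrier)
  then have "det A = 0" using det_transpose[OF A] by simp
  then obtain w where w: "w \<in> carrier_vec n" "w \<noteq> 0\<^sub>v n" "A *\<^sub>v w = 0\<^sub>v n"
    using det_0_iff_vec_prod_zero_field[OF A] by auto
  have fw: "scalar_prod (f i) w = 0" if i: "i \<in> I" for i
  proof -
    obtain k where k: "k < card I" "xs ! k = i" using i xs by (metis in_set_conv_nth)
    have "row A k = f i"
      using k assms(2,3) i by (intro eq_vecI) (auto simp: A_def)
    moreover have "(A *\<^sub>v w) $ k = 0" using w k assms(2) by simp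
    ultimately show ?thesis using A k assms(2) by simp
  qed
  have pos: "scalar_prod w w > 0"
    using w(1,2) conjugate_square_greater_0_vec[of w n] by simp
  define v where "v = (1 / sqrt (scalar_prod w w)) \<cdot>\<^sub>v w"
  have "scalar_prod v v = 1" using pos w(1) by (simp add: v_def field_simps)
  moreover have "v \<in> carrier_vec n" using w by (simp add: v_def)
  moreover have "\<forall>i\<in>I. scalar_prod (f i) v = 0"
    using fw w assms(3) by (simp add: v_def)
  ultimately show ?thesis by blast
qed

text \<open>Adds one orthogonal unit vector at a time. Prescribed members keep their indices, so the
  completed family can be matched column by column with given data.\<close>

lemma orthonormal_extend:
  assumes "finite K" "finite I" "I \<inter> K = {}" "card (I \<union> K) \<le> n" "orthonormal n f I"
  shows "\<exists>g. orthonormal n g (I \<union> K) \<and> (\<forall>i\<in>I. g i = f i)"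
  using assms
proof (induction K rule: finite_induct)
  case empty
  then show ?case by auto
next
  case (insert k K)
  have cd: "card (I \<union> insert k K) = Suc (card (I \<union> K))"
    using insert by (simp add: card_insert_if)
  then obtain g where g: "orthonormal n g (I \<union> K)" "\<forall>i\<in>I. g i = f i"
    using insert by auto
  obtain v where v: "v \<in> carrier_vec n" "scalar_prod v v = 1" "\<forall>i\<in>I \<union> K. scalar_prod (g i) v = 0"
    using exists_orthogonal_unit[of "I \<union> K" n g] g insert cd by (auto simp: orthonormal_def)
  have sym: "scalar_prod v (g i) = 0" if "i \<in> I \<union> K" for i
    using comm_scalar_prod[of v n "g i"] v g that by (auto simp: orthonormal_def)
  have nk: "k \<notin> I \<union> K" using insert by auto
  have "orthonormal n (g(k := v)) (I \<union> insert k K)"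
    using g v sym nk unfolding orthonormal_def by (auto split: if_splits)
  moreover have "\<forall>i\<in>I. (g(k := v)) i = f i" using g nk by auto
  ultimately show ?case by blast
qed

lemma stiefelI_orthonormal:
  assumes "orthonormal n g {..<k}"
  shows "mat n k (\<lambda>(i, j). g j $ i) \<in> stiefel n k"
proof -
  have c: "col (mat n k (\<lambda>(i, j). g j $ i)) j = g j" if "j < k" for j
  proof -
    have "g j \<in> carrier_vec n" using assms that by (auto simp: orthonormal_def)
    then show ?thesis using that by (intro eq_vecI) auto
  qed
  have "transpose_mat (mat n k (\<lambda>(i, j). g j $ i)) * mat n k (\<lambda>(i, j). g j $ i) = 1\<^sub>m k"
    using assms c by (intro eq_matI) (auto simp: orthonormal_def)
  then show ?thesis by (simp add: stiefel_def)
qed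

text \<open>A left inverse of a square matrix is also a right inverse. This lets
  \<open>stiefel_mult\<close> and \<open>stiefelI_orthonormal\<close> produce orthogonal
  matrices.\<close>

lemma stiefel_square: "stiefel n n = orth_group n"
  using mat_mult_left_right_inverse[of "transpose_mat _" n] by (auto simp: stiefel_def orth_group_def)

section \<open>The spectral theorem for real symmetric matrices\<close>

text \<open>A complex root of the characteristic polynomial gives an eigenvector with real part
  \<open>x\<close> and imaginary part \<open>y\<close>. Symmetry makes the eigenvalue real, and then
  whichever of \<open>x\<close> and \<open>y\<close> is nonzero is a real eigenvector.\<close>

lemma real_symmetric_eigenvector:
  fixes A :: "real mat"
  assumes A: "A \<in> carrier_mat n n" and sym: "transpose_mat A = A" and n: "n > 0"
  shows "\<exists>v\<in>carrier_vec n. \<exists>l. v \<noteq> 0\<^sub>v n \<and> A *\<^sub>v v = l \<cdot>\<^sub>v v"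
proof -
  let ?C = "map_mat complex_of_real A"
  have C: "?C \<in> carrier_mat n n" using A by simp
  obtain as where as: "char_poly ?C = (\<Prod>a\<leftarrow>as. [:- a, 1:])" "length as = n"
    using char_poly_factorized[OF C] by blast
  then obtain l where "l \<in> set as" using n by (metis length_0_conv less_numeral_extra(3) list.set_intros(1) neq_Nil_conv)
  then have "poly (char_poly ?C) l = 0"
    unfolding as(1) poly_prod_list by (auto simp: prod_list_zero_iff)
  then have "eigenvalue ?C l" using eigenvalue_root_char_poly[OF C] by simp
  then obtain z where z: "z \<in> carrier_vec n" "z \<noteq> 0\<^sub>v n" "?C *\<^sub>v z = l \<cdot>\<^sub>v z"
    using C by (auto simp: eigenvalue_def eigenvector_def)
  define x where "x = map_vec Re z"
  define y where "y = map_vec Im z"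
  have x: "x \<in> carrier_vec n" and y: "y \<in> carrier_vec n" using z by (auto simp: x_def y_def)
  have eq: "(\<Sum>j<n. complex_of_real (A $$ (i, j)) * z $ j) = l * z $ i" if "i < n" for i
    using arg_cong[OF z(3), of "\<lambda>v. v $ i"] that A z(1)
    by (simp add: scalar_prod_def atLeast0LessThan)
  have Ax: "A *\<^sub>v x = Re l \<cdot>\<^sub>v x - Im l \<cdot>\<^sub>v y"
  proof (rule eq_vecI)
    fix i assume "i < dim_vec (Re l \<cdot>\<^sub>v x - Im l \<cdot>\<^sub>v y)"
    then have i: "i < n" using y by simp
    have "(A *\<^sub>v x) $ i = Re (\<Sum>j<n. complex_of_real (A $$ (i, j)) * z $ j)"
      using i A z(1) by (simp add: scalar_prod_def atLeast0LessThan x_def)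
    then show "(A *\<^sub>v x) $ i = (Re l \<cdot>\<^sub>v x - Im l \<cdot>\<^sub>v y) $ i"
      using i eq[OF i] z(1) by (simp add: x_def y_def)
  qed (use A y in simp)
  have Ay: "A *\<^sub>v y = Re l \<cdot>\<^sub>v y + Im l \<cdot>\<^sub>v x"
  proof (rule eq_vecI)
    fix i assume "i < dim_vec (Re l \<cdot>\<^sub>v y + Im l \<cdot>\<^sub>v x)"
    then have i: "i < n" using x by simp
    have "(A *\<^sub>v y) $ i = Im (\<Sum>j<n. complex_of_real (A $$ (i, j)) * z $ j)"
      using i A z(1) by (simp add: scalar_prod_def atLeast0LessThan y_def)
    then show "(A *\<^sub>v y) $ i = (Re l \<cdot>\<^sub>v y + Im l \<cdot>\<^sub>v x) $ i"
      using i eq[OF i] z(1) by (simp add: x_def y_def)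
  qed (use A x in simp)
  \<comment> \<open>By symmetry of \<open>A\<close>. Inserting \<open>Ax\<close> and
    \<open>Ay\<close>, the terms with \<open>Re l\<close> cancel and \<open>Im l\<close> times a
    positive number remains.\<close>
  have "scalar_prod x (A *\<^sub>v y) = scalar_prod y (A *\<^sub>v x)"
    using transpose_vec_mult_scalar[OF A y x] sym comm_scalar_prod[OF x] A y
    by (metis comm_scalar_prod mult_mat_vec_carrier x)
  then have key: "Im l * (scalar_prod x x + scalar_prod y y) = 0"
    using x y comm_scalar_prod[OF x y] unfolding Ax Ay
    by (simp add: scalar_prod_add_distrib[of _ n] scalar_prod_minus_distrib[of _ n] algebra_simps)
  have xy: "x \<noteq> 0\<^sub>v n \<or> y \<noteq> 0\<^sub>v n"
  proof (rule ccontr)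
    assume "\<not> ?thesis"
    then have "z $ i = 0" if "i < n" for i
      using that z(1) arg_cong[of x "0\<^sub>v n" "\<lambda>v. v $ i"] arg_cong[of y "0\<^sub>v n" "\<lambda>v. v $ i"]
        index_map_vec(1)[of i z Re] index_map_vec(1)[of i z Im] \<open>\<not> (x \<noteq> 0\<^sub>v n \<or> y \<noteq> 0\<^sub>v n)\<close>
      unfolding x_def y_def complex_eq_iff by (metis carrier_vecD index_zero_vec(1) zero_complex.sel)
    then have "z = 0\<^sub>v n" using z(1) by (intro eq_vecI) auto
    then show False using z(2) by simp
  qed
  have "scalar_prod x x + scalar_prod y y > 0"
    using xy x y conjugate_square_greater_0_vec[of x n] conjugate_square_greater_0_vec[of y n]
      conjugate_square_ge_0_vec[of x] conjugate_square_ge_0_vec[of y]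
    by (auto simp: add_pos_nonneg add_nonneg_pos)
  then have "Im l = 0" using key by simp
  then have "A *\<^sub>v x = Re l \<cdot>\<^sub>v x" "A *\<^sub>v y = Re l \<cdot>\<^sub>v y"
    using Ax Ay x y by (auto intro!: eq_vecI)
  then show ?thesis using xy x y by blast
qed

text \<open>The last fact has a free tail \<open>Z\<close>, so that cancellation also works inside
  products nested to the right by \<open>mult_assoc_dim\<close>; \<open>orth_groupD\<close> does the
  same.\<close>

lemma stiefelD:
  assumes "Q \<in> stiefel n p"
  shows "Q \<in> carrier_mat n p" "dim_row Q = n" "dim_col Q = p" "transpose_mat Q * Q = 1\<^sub>m p"
    "dim_row Z = p \<Longrightarrow> transpose_mat Q * (Q * Z) = Z"
proof -
  show *: "Q \<in> carrier_mat n p" "dim_row Q = n" "dim_col Q = p" "transpose_mat Q * Q = 1\<^sub>m p"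
    using assms by (auto simp: stiefel_def)
  show "transpose_mat Q * (Q * Z) = Z" if "dim_row Z = p"
    using that * by (subst mult_assoc_dim[symmetric]) auto
qed

lemma orth_groupD:
  assumes "U \<in> orth_group n"
  shows "U \<in> carrier_mat n n" "dim_row U = n" "dim_col U = n"
    "transpose_mat U * U = 1\<^sub>m n" "U * transpose_mat U = 1\<^sub>m n"
    "dim_row Z = n \<Longrightarrow> transpose_mat U * (U * Z) = Z"
    "dim_row Z = n \<Longrightarrow> U * (transpose_mat U * Z) = Z"
proof -
  show *: "U \<in> carrier_mat n n" "dim_row U = n" "dim_col U = n"
    "transpose_mat U * U = 1\<^sub>m n" "U * transpose_mat U = 1\<^sub>m n"
    using assms by (auto simp: orth_group_def)
  show "dim_row Z = n \<Longrightarrow> transpose_mat U * (U * Z) = Z"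
    "dim_row Z = n \<Longrightarrow> U * (transpose_mat U * Z) = Z"
    using * by (simp_all flip: mult_assoc_dim)
qed

lemma stiefel_mult:
  assumes "Q \<in> stiefel n p" "R \<in> stiefel p q"
  shows "Q * R \<in> stiefel n q"
  using stiefelD[OF assms(1)] stiefelD[OF assms(2)]
  by (simp add: stiefel_def transpose_mult_dim mult_assoc_dim)

lemma orth_group_transpose: "U \<in> orth_group n \<Longrightarrow> transpose_mat U \<in> orth_group n"
  by (simp add: orth_group_def)

text \<open>Induction on the dimension. A unit eigenvector is completed to an orthonormal basis
  \<open>G\<close>; conjugation by \<open>G\<close> splits off its eigenvalue and leaves a symmetric
  block that is one size smaller.\<close>

lemma real_spectral:
  fixes A :: "real mat"
  assumes "A \<in> carrier_mat n n" "transpose_mat A = A"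
  shows "\<exists>W\<in>orth_group n. \<exists>d. A = W * mat_diag n d * transpose_mat W"
  using assms
proof (induction n arbitrary: A)
  case 0
  have "1\<^sub>m 0 \<in> orth_group 0" by (simp add: orth_group_def)
  moreover have "A = 1\<^sub>m 0 * mat_diag 0 (\<lambda>_. 0) * transpose_mat (1\<^sub>m 0)"
    using 0 by (intro eq_matI) auto
  ultimately show ?case by blast
next
  case (Suc n)
  have dA [simp]: "dim_row A = Suc n" "dim_col A = Suc n" using Suc.prems by auto
  obtain v l where v: "v \<in> carrier_vec (Suc n)" "v \<noteq> 0\<^sub>v (Suc n)" "A *\<^sub>v v = l \<cdot>\<^sub>v v"
    using real_symmetric_eigenvector[OF Suc.prems] by auto
  have pos: "scalar_prod v v > 0" using v conjugate_square_greater_0_vec[of v "Suc n"] by simp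
  define u where "u = (1 / sqrt (scalar_prod v v)) \<cdot>\<^sub>v v"
  have u: "u \<in> carrier_vec (Suc n)" "scalar_prod u u = 1"
    using pos v(1) by (auto simp: u_def field_simps)
  have Au: "A *\<^sub>v u = l \<cdot>\<^sub>v u"
    unfolding u_def using v Suc.prems(1)
    by (simp add: mult_mat_vec[of A "Suc n" "Suc n"] smult_smult_assoc mult.commute)
  have K: "{0} \<union> {1..<Suc n} = {..<Suc n}" by auto
  have "orthonormal (Suc n) (\<lambda>_. u) {0}" using u by (simp add: orthonormal_def)
  from orthonormal_extend[OF _ _ _ _ this, of "{1..<Suc n}", unfolded K]
  obtain g where g: "orthonormal (Suc n) g {..<Suc n}" "g 0 = u" by auto
  define G where "G = mat (Suc n) (Suc n) (\<lambda>(i, j). g j $ i)"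
  have G: "G \<in> orth_group (Suc n)"
    using stiefelI_orthonormal[OF g(1)] by (simp add: G_def stiefel_square)
  note [simp] = orth_groupD[OF G]
  have gc: "g j \<in> carrier_vec (Suc n)" if "j < Suc n" for j
    using g(1) that by (auto simp: orthonormal_def)
  have colG: "col G j = g j" if "j < Suc n" for j
    using gc[OF that] that by (intro eq_vecI) (auto simp: G_def)
  define B where "B = transpose_mat G * (A * G)"
  have B: "B \<in> carrier_mat (Suc n) (Suc n)" by (rule carrier_matI) (simp_all add: B_def)
  have dB [simp]: "dim_row B = Suc n" "dim_col B = Suc n" using B by auto
  have symB: "transpose_mat B = B" using Suc.prems(2)
    by (simp add: B_def transpose_mult_dim mult_assoc_dim)
  have symB': "B $$ (i, j) = B $$ (j, i)" if "i < Suc n" "j < Suc n" for i j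
    using that arg_cong[OF symB, of "\<lambda>M. M $$ (j, i)"] by simp
  \<comment> \<open>The first column of \<open>G\<close> is the eigenvector \<open>u\<close>, and
    the other columns are orthogonal to it.\<close>
  have B0: "B $$ (i, 0) = (if i = 0 then l else 0)" if "i < Suc n" for i
  proof -
    have "B $$ (i, 0) = scalar_prod (col G i) (A *\<^sub>v col G 0)"
      using that Suc.prems(1) by (simp add: B_def col_mult2[of A "Suc n" "Suc n" G "Suc n"])
    also have "\<dots> = l * scalar_prod (g i) (g 0)"
      using that g(2) Au gc[OF that] u(1) by (simp add: colG)
    finally show ?thesis using that g(1) by (auto simp: orthonormal_def)
  qed
  have B0': "B $$ (0, i) = (if i = 0 then l else 0)" if "i < Suc n" for i
    using B0[OF that] symB'[of 0 i] that by simp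
  define A' where "A' = mat n n (\<lambda>(i, j). B $$ (Suc i, Suc j))"
  have A': "A' \<in> carrier_mat n n" by (simp add: A'_def)
  have "transpose_mat A' = A'"
    using symB' by (intro eq_matI) (auto simp: A'_def)
  then obtain W d where W: "W \<in> orth_group n" and A'W: "A' = W * mat_diag n d * transpose_mat W"
    using Suc.IH[OF A'] by blast
  note W' [simp] = orth_groupD[OF W]
  \<comment> \<open>Extends \<open>W\<close> by a 1 by 1 identity block, so that the split-off
    eigenvalue \<open>l\<close> is left alone; \<open>e\<close> puts \<open>l\<close> in front of
    \<open>d\<close>.\<close>
  define W2 where "W2 = four_block_mat (1\<^sub>m 1) (0\<^sub>m 1 n) (0\<^sub>m n 1) W"
  define e where "e = (\<lambda>i. case i of 0 \<Rightarrow> l | Suc j \<Rightarrow> d j)"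
  have tW2: "transpose_mat W2 = four_block_mat (1\<^sub>m 1) (0\<^sub>m 1 n) (0\<^sub>m n 1) (transpose_mat W)"
    unfolding W2_def by (subst transpose_four_block_mat) auto
  have "W2 \<in> carrier_mat (1 + n) (1 + n)" unfolding W2_def by (rule four_block_carrier_mat) auto
  then have W2c: "W2 \<in> carrier_mat (Suc n) (Suc n)" by simp
  have o1: "four_block_mat (1\<^sub>m 1) (0\<^sub>m 1 n) (0\<^sub>m n 1) (1\<^sub>m n) = (1\<^sub>m (Suc n) :: real mat)"
    by (simp add: four_block_one_mat)
  have "transpose_mat W2 * W2 = 1\<^sub>m (Suc n)" unfolding tW2 unfolding W2_def
    by (subst mult_four_block_mat[of _ 1 1 _ n _ n _ _ 1 _ n]) (auto simp: o1)
  moreover have "W2 * transpose_mat W2 = 1\<^sub>m (Suc n)" unfolding tW2 unfolding W2_def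
    by (subst mult_four_block_mat[of _ 1 1 _ n _ n _ _ 1 _ n]) (auto simp: o1)
  ultimately have W2: "W2 \<in> orth_group (Suc n)" using W2c by (simp add: orth_group_def)
  note [simp] = orth_groupD[OF W2]
  have D: "mat_diag (Suc n) e = four_block_mat (mat 1 1 (\<lambda>_. l)) (0\<^sub>m 1 n) (0\<^sub>m n 1) (mat_diag n d)"
    by (intro eq_matI) (auto simp: mat_diag_def e_def split: nat.splits)
  have dc: "mat_diag n d \<in> carrier_mat n n" by simp
  have "W2 * mat_diag (Suc n) e = four_block_mat (mat 1 1 (\<lambda>_. l)) (0\<^sub>m 1 n) (0\<^sub>m n 1) (W * mat_diag n d)"
    unfolding D unfolding W2_def using dc mult_carrier_mat[OF W'(1) dc]
    by (subst mult_four_block_mat[of _ 1 1 _ n _ n _ _ 1 _ n])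
      (auto simp: left_mult_zero_mat[OF dc] left_add_zero_mat)
  also have "\<dots> * transpose_mat W2 = four_block_mat (mat 1 1 (\<lambda>_. l)) (0\<^sub>m 1 n) (0\<^sub>m n 1) A'"
    unfolding tW2 A'W using dc mult_carrier_mat[OF W'(1) dc]
    by (subst mult_four_block_mat[of _ 1 1 _ n _ n _ _ 1 _ n]) (auto)
  also have "\<dots> = B"
    using B0 B0' by (intro eq_matI) (auto simp: A'_def)
  finally have BW: "B = W2 * mat_diag (Suc n) e * transpose_mat W2" by simp
  have dd [simp]: "dim_row (mat_diag (Suc n) e) = Suc n" "dim_col (mat_diag (Suc n) e) = Suc n"
    by (simp_all add: mat_diag_def)
  have "G * (B * transpose_mat G) = A"
    by (simp add: B_def mult_assoc_dim right_mult_one_mat')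
  then have "A = (G * W2) * mat_diag (Suc n) e * transpose_mat (G * W2)"
    unfolding BW by (simp add: mult_assoc_dim transpose_mult_dim)
  moreover have "G * W2 \<in> orth_group (Suc n)"
    using stiefel_mult[of G "Suc n" "Suc n" W2 "Suc n"] G W2 by (simp add: stiefel_square)
  ultimately show ?case by blast
qed

section \<open>Trace, positive semidefinite matrices and the nuclear norm\<close>

lemma mat_trace_sum: "mat_trace A = (\<Sum>i<dim_row A. A $$ (i, i))"
  by (simp add: mat_trace_def diag_mat_def sum_list_distinct_conv_sum_set atLeast0LessThan)

lemma mat_trace_mult_comm:
  assumes "dim_col A = dim_row B" "dim_col B = dim_row A"
  shows "mat_trace (A * B) = mat_trace (B * A)"
proof -
  have "mat_trace (A * B) = (\<Sum>i<dim_row A. \<Sum>j<dim_row B. A $$ (i, j) * B $$ (j, i))"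
    using assms by (simp add: mat_trace_sum scalar_prod_def atLeast0LessThan)
  also have "\<dots> = (\<Sum>j<dim_row B. \<Sum>i<dim_row A. B $$ (j, i) * A $$ (i, j))"
    by (subst sum.swap) (simp add: mult.commute)
  also have "\<dots> = mat_trace (B * A)"
    using assms by (simp add: mat_trace_sum scalar_prod_def atLeast0LessThan)
  finally show ?thesis .
qed

lemma mat_trace_transpose: "dim_row A = dim_col A \<Longrightarrow> mat_trace (transpose_mat A) = mat_trace A"
  by (simp add: mat_trace_sum)

lemma mat_trace_add:
  "dim_row A = dim_row B \<Longrightarrow> dim_col A = dim_col B \<Longrightarrow> dim_row A = dim_col A \<Longrightarrow>
    mat_trace (A + B) = mat_trace A + mat_trace B"
  by (simp add: mat_trace_sum sum.distrib)

lemma mat_trace_minus: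
  "dim_row A = dim_row B \<Longrightarrow> dim_col A = dim_col B \<Longrightarrow> dim_row A = dim_col A \<Longrightarrow>
    mat_trace (A - B) = mat_trace A - mat_trace B"
  by (simp add: mat_trace_sum sum_subtractf)

lemma mat_trace_smult: "dim_row A = dim_col A \<Longrightarrow> mat_trace (c \<cdot>\<^sub>m A) = c * mat_trace A"
  by (simp add: mat_trace_sum sum_distrib_left)

lemma mat_trace_mat_diag: "mat_trace (mat_diag n d) = (\<Sum>i<n. d i)"
  by (simp add: mat_trace_sum mat_diag_def)

text \<open>Frobenius inner products are written as traces throughout; this identity supplies their
  definiteness.\<close>

lemma mat_trace_gram: "mat_trace (transpose_mat Z * Z) = (\<Sum>j<dim_col Z. \<Sum>i<dim_row Z. (Z $$ (i, j))\<^sup>2)"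
  by (simp add: mat_trace_sum scalar_prod_def atLeast0LessThan power2_eq_square)

lemma mat_trace_gram_nonneg: "mat_trace (transpose_mat Z * Z) \<ge> 0"
  by (simp add: mat_trace_gram sum_nonneg)

lemma mat_trace_gram_eq_0:
  assumes "mat_trace (transpose_mat Z * Z) = 0"
  shows "Z = 0\<^sub>m (dim_row Z) (dim_col Z)"
proof (rule eq_matI)
  fix i j assume "i < dim_row (0\<^sub>m (dim_row Z) (dim_col Z))" "j < dim_col (0\<^sub>m (dim_row Z) (dim_col Z))"
  moreover from this have "(\<Sum>i<dim_row Z. (Z $$ (i, j))\<^sup>2) = 0"
    using assms by (auto simp: mat_trace_gram sum_nonneg_eq_0_iff sum_nonneg)
  ultimately show "Z $$ (i, j) = 0\<^sub>m (dim_row Z) (dim_col Z) $$ (i, j)"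
    by (auto simp: sum_nonneg_eq_0_iff)
qed auto

lemma mat_diag_dims [simp]: "dim_row (mat_diag n d) = n" "dim_col (mat_diag n d) = n"
  by (simp_all add: mat_diag_def)

lemma transpose_mat_diag [simp]: "transpose_mat (mat_diag n d) = mat_diag n d"
  by (intro eq_matI) (auto simp: mat_diag_def)

lemma mat_diag_cong: "(\<And>i. i < n \<Longrightarrow> d i = e i) \<Longrightarrow> mat_diag n d = mat_diag n e"
  by (intro eq_matI) (auto simp: mat_diag_def)

text \<open>Right-nested, to fit the normal form of \<open>mult_assoc_dim\<close>: adjacent diagonal
  factors merge even when a further factor follows.\<close>

lemma mat_diag_mult_assoc [simp]:
  "dim_row Z = n \<Longrightarrow> mat_diag n d * (mat_diag n e * Z) = mat_diag n (\<lambda>i. d i * (e i :: real)) * Z"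
  by (subst mult_assoc_dim[symmetric]) auto

section \<open>Positive semidefinite matrices\<close>

lemma psd_matsD:
  assumes "T \<in> psd_mats n"
  shows "T \<in> carrier_mat n n" "dim_row T = n" "dim_col T = n" "transpose_mat T = T"
    "v \<in> carrier_vec n \<Longrightarrow> scalar_prod v (T *\<^sub>v v) \<ge> 0"
  using assms by (auto simp: psd_mats_def)

text \<open>The new quadratic form at \<open>v\<close> is the form of \<open>T\<close> at
  \<open>Z v\<close>.\<close>

lemma psd_mats_congruence:
  assumes T: "T \<in> psd_mats n" and Z: "Z \<in> carrier_mat n p"
  shows "transpose_mat Z * T * Z \<in> psd_mats p"
proof -
  note [simp] = psd_matsD(2-4)[OF T] carrier_matD[OF Z]
  have "scalar_prod v ((transpose_mat Z * T * Z) *\<^sub>v v) \<ge> 0" if v: "v \<in> carrier_vec p" for v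
  proof -
    have Zv: "Z *\<^sub>v v \<in> carrier_vec n" using Z v by simp
    have "(transpose_mat Z * T * Z) *\<^sub>v v = transpose_mat Z *\<^sub>v (T *\<^sub>v (Z *\<^sub>v v))"
      using Z v psd_matsD(1)[OF T]
      by (simp add: mult_assoc_dim assoc_mult_mat_vec[of _ p n _ p] assoc_mult_mat_vec[of _ n n _ p]
          mult_carrier_mat[of T n n Z p])
    then have "scalar_prod v ((transpose_mat Z * T * Z) *\<^sub>v v) = scalar_prod (Z *\<^sub>v v) (T *\<^sub>v (Z *\<^sub>v v))"
      using transpose_vec_mult_scalar[OF Z v, of "T *\<^sub>v (Z *\<^sub>v v)"] psd_matsD(1)[OF T] Zv v Z
      by (metis comm_scalar_prod mult_mat_vec_carrier transpose_carrier_mat)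
    then show ?thesis using psd_matsD(5)[OF T Zv] by simp
  qed
  then show ?thesis
    by (auto simp: psd_mats_def transpose_mult_dim mult_assoc_dim)
qed

lemma mat_diag_quadratic_form:
  fixes v :: "real vec"
  assumes v: "v \<in> carrier_vec n"
  shows "scalar_prod v (mat_diag n d *\<^sub>v v) = (\<Sum>i<n. d i * (v $ i)\<^sup>2)"
proof -
  have *: "(mat_diag n d *\<^sub>v v) $ i = d i * v $ i" if "i < n" for i
    using that v by (simp add: mat_diag_def scalar_prod_def if_distrib[of "\<lambda>x. x * _"] cong: if_cong)
  then show ?thesis
    unfolding scalar_prod_def[of v] atLeast0LessThan power2_eq_square
    by (intro sum.cong) (simp_all add: * power2_eq_square mult_ac del: index_mult_mat_vec)
qed

lemma mat_diag_psd:
  assumes "\<And>i. i < n \<Longrightarrow> d i \<ge> 0"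
  shows "mat_diag n d \<in> psd_mats n"
  using assms by (auto simp: psd_mats_def mat_diag_quadratic_form intro!: sum_nonneg)

text \<open>The diagonal factor is congruent to \<open>T\<close>, hence positive semidefinite, and
  its entries are the values of its quadratic form at the unit vectors.\<close>

lemma psd_spectral:
  assumes T: "T \<in> psd_mats n"
  shows "\<exists>W\<in>orth_group n. \<exists>d. (\<forall>i<n. d i \<ge> 0) \<and> T = W * mat_diag n d * transpose_mat W"
proof -
  obtain W d where W: "W \<in> orth_group n" and TW: "T = W * mat_diag n d * transpose_mat W"
    using real_spectral psd_matsD[OF T] by blast
  note [simp] = orth_groupD[OF W]
  have "mat_diag n d = transpose_mat W * T * W"
    unfolding TW by (simp add: mult_assoc_dim right_mult_one_mat')
  then have P: "mat_diag n d \<in> psd_mats n" using psd_mats_congruence[OF T] by simp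
  have "d i \<ge> 0" if "i < n" for i
    using psd_matsD(5)[OF P, of "unit_vec n i"] that
    by (simp add: mat_diag_quadratic_form unit_vec_def if_distrib[of "\<lambda>x. x\<^sup>2"]
        if_distrib[of "\<lambda>x. _ * x"] cong: if_cong)
  then show ?thesis using W TW by blast
qed

lemma psd_sqrt:
  assumes T: "T \<in> psd_mats n"
  shows "\<exists>S\<in>psd_mats n. S * S = T"
proof -
  obtain W d where W: "W \<in> orth_group n" and d: "\<forall>i<n. d i \<ge> 0"
    and TW: "T = W * mat_diag n d * transpose_mat W"
    using psd_spectral[OF T] by blast
  note [simp] = orth_groupD[OF W]
  define S where "S = W * mat_diag n (\<lambda>i. sqrt (d i)) * transpose_mat W"
  have "S \<in> psd_mats n" unfolding S_def
    using psd_mats_congruence[OF mat_diag_psd, of n "\<lambda>i. sqrt (d i)" "transpose_mat W" n] d by simp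
  moreover have "mat_diag n (\<lambda>i. sqrt (d i) * sqrt (d i)) = mat_diag n d"
    using d by (intro mat_diag_cong) auto
  then have "S * S = T" unfolding S_def TW by (simp add: mult_assoc_dim)
  ultimately show ?thesis by blast
qed

section \<open>Singular values, nuclear norm and polar decomposition\<close>

lemma proots_prod_linear:
  fixes f :: "'a \<Rightarrow> real"
  shows "proots (\<Prod>x\<leftarrow>xs. [:- f x, 1:]) = mset (map f xs)"
proof (induction xs)
  case (Cons x xs)
  have "(\<Prod>x\<leftarrow>xs. [:- f x, 1:]) \<noteq> 0" by (auto simp: prod_list_zero_iff)
  then show ?case using Cons by (simp add: proots_mult del: mult_pCons_left)
qed simp

text \<open>Similarity to a diagonal matrix factors the characteristic polynomial into linear terms
  with roots \<open>s i * s i\<close>; nonnegativity of \<open>s\<close> lets \<open>sqrt\<close>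
  undo the square.\<close>

lemma singular_values_eq:
  assumes W: "W \<in> orth_group p" and s: "\<And>i. i < p \<Longrightarrow> s i \<ge> 0"
    and X: "transpose_mat X * X = W * mat_diag p (\<lambda>i. s i * s i) * transpose_mat W"
  shows "singular_values X = rev (sort (map s [0..<p]))"
proof -
  note [simp] = orth_groupD[OF W]
  let ?D = "mat_diag p (\<lambda>i. s i * s i)"
  have "similar_mat_wit (transpose_mat X * X) ?D W (transpose_mat W)"
    by (rule similar_mat_witI[of _ _ p]) (use X in \<open>auto intro!: carrier_matI\<close>)
  then have "char_poly (transpose_mat X * X) = char_poly ?D"
    by (intro char_poly_similar) (auto simp: similar_mat_def)
  also have "\<dots> = (\<Prod>a\<leftarrow>diag_mat ?D. [:- a, 1:])"
    by (rule char_poly_upper_triangular[of _ p]) (auto simp: mat_diag_def)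
  also have "diag_mat ?D = map (\<lambda>i. s i * s i) [0..<p]"
    by (simp add: diag_mat_def mat_diag_def)
  finally have "proots (char_poly (transpose_mat X * X)) =
      proots (\<Prod>i\<leftarrow>[0..<p]. [:- (s i * s i), 1:])"
    by (simp add: o_def)
  also have "\<dots> = mset (map (\<lambda>i. s i * s i) [0..<p])"
    by (rule proots_prod_linear)
  finally have "image_mset sqrt (proots (char_poly (transpose_mat X * X))) =
      mset (map (\<lambda>i. sqrt (s i * s i)) [0..<p])"
    by (simp add: o_def flip: mset_map)
  also have "map (\<lambda>i. sqrt (s i * s i)) [0..<p] = map s [0..<p]"
    using s by (intro map_cong) auto
  finally show ?thesis by (simp only: singular_values_def sorted_list_of_multiset_mset)
qed

text \<open>\<open>T\<close> acts as the square root of X^T X. Diagonalizing it shows that its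
  eigenvalues are the singular values of \<open>X\<close>, and their sum does not depend on the
  order.\<close>

lemma nuclear_norm_psd:
  assumes T: "T \<in> psd_mats p" and X: "transpose_mat X * X = T * T"
  shows "nuclear_norm X = mat_trace T"
proof -
  obtain W d where W: "W \<in> orth_group p" and d: "\<forall>i<p. d i \<ge> 0"
    and TW: "T = W * mat_diag p d * transpose_mat W"
    using psd_spectral[OF T] by blast
  note [simp] = orth_groupD[OF W]
  have "transpose_mat X * X = W * mat_diag p (\<lambda>i. d i * d i) * transpose_mat W"
    unfolding X TW by (simp add: mult_assoc_dim)
  then have "nuclear_norm X = sum_list (rev (sort (map d [0..<p])))"
    using singular_values_eq[OF W, of d X] d by (simp add: nuclear_norm_def)
  also have "\<dots> = sum_list (map d [0..<p])"
    by (metis mset_rev mset_sort sum_mset_sum_list)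
  also have "\<dots> = mat_trace (mat_diag p d)"
    by (simp add: mat_trace_mat_diag sum_list_distinct_conv_sum_set atLeast0LessThan)
  also have "\<dots> = mat_trace T"
    unfolding TW by (subst mat_trace_mult_comm) (simp_all flip: mult_assoc_dim)
  finally show ?thesis .
qed

text \<open>If \<open>W\<close> diagonalizes X^T X, the columns of \<open>X * W\<close> are
  orthogonal. The nonzero ones are normalized and completed to \<open>p\<close> orthonormal vectors,
  for which \<open>p <= n\<close> leaves room; undoing \<open>W\<close> gives both factors.\<close>

lemma polar_decomposition:
  assumes X: "X \<in> carrier_mat n p" and np: "p \<le> n"
  shows "\<exists>G\<in>stiefel n p. \<exists>T\<in>psd_mats p. X = G * T"
proof -
  note [simp] = carrier_matD[OF X]
  have XX: "transpose_mat X * X \<in> psd_mats p"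
    using psd_mats_congruence[OF mat_diag_psd[of n "\<lambda>_. 1"] X] by (simp add: X)
  obtain W d where W: "W \<in> orth_group p" and d: "\<forall>i<p. d i \<ge> 0"
    and XW: "transpose_mat X * X = W * mat_diag p d * transpose_mat W"
    using psd_spectral[OF XX] by blast
  note [simp] = orth_groupD[OF W]
  have "transpose_mat W * (transpose_mat X * X) * W = mat_diag p d"
    unfolding XW by (simp add: mult_assoc_dim right_mult_one_mat')
  then have gram: "transpose_mat (X * W) * (X * W) = mat_diag p d"
    by (simp add: mult_assoc_dim transpose_mult_dim)
  define y where "y = (\<lambda>i. col (X * W) i)"
  have y: "y i \<in> carrier_vec n" for i unfolding y_def by (rule carrier_vecI) simp
  have yy: "scalar_prod (y i) (y j) = (if i = j then d i else 0)" if "i < p" "j < p" for i j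
    using arg_cong[OF gram, of "\<lambda>M. M $$ (i, j)"] that by (auto simp: y_def mat_diag_def)
  \<comment> \<open>By \<open>yy\<close>, \<open>d i\<close> is the squared norm of
    \<open>y i\<close>, so these are the columns that can be normalized.\<close>
  define I where "I = {i. i < p \<and> d i \<noteq> 0}"
  define f where "f = (\<lambda>i. (1 / sqrt (d i)) \<cdot>\<^sub>v y i)"
  have ff: "scalar_prod (f i) (f j) = (1 / sqrt (d i)) * (1 / sqrt (d j)) * scalar_prod (y i) (y j)" for i j
    using y[of i] y[of j] by (simp add: f_def)
  have "orthonormal n f I"
    unfolding orthonormal_def ff using y d yy by (auto simp: f_def I_def)
  moreover have Ip: "I \<union> ({..<p} - I) = {..<p}" by (auto simp: I_def)
  ultimately obtain g where g: "orthonormal n g {..<p}" and gf: "\<forall>i\<in>I. g i = f i"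
    using orthonormal_extend[of "{..<p} - I" I n f] np by (auto simp: I_def)
  define G where "G = mat n p (\<lambda>(i, j). g j $ i)"
  have G: "G \<in> stiefel n p" using stiefelI_orthonormal[OF g] by (simp add: G_def)
  note [simp] = stiefelD[OF G]
  define D where "D = mat_diag p (\<lambda>i. sqrt (d i))"
  have [simp]: "dim_row D = p" "dim_col D = p" by (simp_all add: D_def)
  have "X * W = G * D"
  proof (rule eq_matI)
    fix i j assume "i < dim_row (G * D)" "j < dim_col (G * D)"
    then have ij: "i < n" "j < p" by simp_all
    have "(G * D) $$ (i, j) = g j $ i * sqrt (d j)"
      using ij unfolding D_def by (subst mat_diag_mult_right[of _ n]) (auto simp: G_def)
    \<comment> \<open>Where \<open>d j = 0\<close>, the column \<open>y j\<close> is zero and the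
      arbitrary completing vector \<open>g j\<close> is multiplied by zero.\<close>
    also have "\<dots> = y j $ i"
    proof (cases "d j = 0")
      case True
      then have "scalar_prod (y j) (y j) = 0" using yy ij by simp
      then have "y j = 0\<^sub>v n" using y[of j] conjugate_square_greater_0_vec[of "y j" n] by auto
      then show ?thesis using True ij by simp
    next
      case False
      then have "g j = f j" using gf ij by (simp add: I_def)
      then show ?thesis using False ij d y[of j] by (simp add: f_def)
    qed
    finally show "(X * W) $$ (i, j) = (G * D) $$ (i, j)"
      using ij by (simp add: y_def)
  qed simp_all
  moreover have "X = X * W * transpose_mat W"
    by (simp add: mult_assoc_dim right_mult_one_mat[OF X])
  ultimately have "X = (G * transpose_mat W) * (W * D * transpose_mat W)"
    by (simp add: mult_assoc_dim)
  moreover have "G * transpose_mat W \<in> stiefel n p"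
    using stiefel_mult[OF G] orth_group_transpose[OF W] by (simp flip: stiefel_square)
  moreover have "W * D * transpose_mat W \<in> psd_mats p"
    using psd_mats_congruence[OF mat_diag_psd, of p "\<lambda>i. sqrt (d i)" "transpose_mat W" p] d
    by (simp add: D_def)
  ultimately show ?thesis by blast
qed

lemma nuclear_norm_polar:
  assumes G: "G \<in> stiefel n p" and T: "T \<in> psd_mats p"
  shows "nuclear_norm (G * T) = mat_trace T"
proof (rule nuclear_norm_psd[OF T])
  note [simp] = stiefelD[OF G] psd_matsD(2-4)[OF T]
  show "transpose_mat (G * T) * (G * T) = T * T"
    by (simp add: transpose_mult_dim mult_assoc_dim)
qed

section \<open>The trace inequality and its equality case\<close>

text \<open>Expand the square. The outer terms reduce to \<open>S * S\<close> because both factors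
  have orthonormal columns, and the cross terms are transposes of each other, hence equal in
  trace.\<close>

lemma trace_gap:
  assumes Q: "Q \<in> stiefel n p" and G: "G \<in> stiefel n p" and S: "S \<in> psd_mats p"
  shows "mat_trace (transpose_mat ((Q - G) * S) * ((Q - G) * S)) =
    2 * (mat_trace (S * S) - mat_trace (transpose_mat Q * (G * (S * S))))"
proof -
  note [simp] = stiefelD[OF Q] stiefelD[OF G] psd_matsD(2-4)[OF S]
  let ?A = "S * (transpose_mat Q * (G * S))" and ?B = "S * (transpose_mat G * (Q * S))"
  have "transpose_mat ((Q - G) * S) * ((Q - G) * S) = (S * S - ?B) - (?A - S * S)"
    by (simp add: transpose_mult_dim transpose_minus_dim minus_mult_distrib_dim
        mult_minus_distrib_dim mult_assoc_dim)
  moreover have "mat_trace ?B = mat_trace ?A"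
    by (subst mat_trace_transpose[symmetric]) (simp_all add: transpose_mult_dim mult_assoc_dim)
  moreover have "mat_trace ?A = mat_trace (transpose_mat Q * (G * (S * S)))"
    by (subst mat_trace_mult_comm) (simp_all add: mult_assoc_dim)
  ultimately show ?thesis by (simp add: mat_trace_minus)
qed

text \<open>Apply \<open>trace_gap\<close> to a square root \<open>S\<close> of \<open>T\<close>.
  Equality makes \<open>(Q - G) * S\<close> vanish, and one more factor \<open>S\<close> turns this
  into a statement about \<open>T\<close>.\<close>

lemma trace_le_nuclear_norm:
  assumes Q: "Q \<in> stiefel n p" and G: "G \<in> stiefel n p" and T: "T \<in> psd_mats p"
  shows "mat_trace (transpose_mat Q * (G * T)) \<le> mat_trace T"
    and "mat_trace (transpose_mat Q * (G * T)) = mat_trace T \<Longrightarrow> Q * T = G * T"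
proof -
  obtain S where S: "S \<in> psd_mats p" "S * S = T" using psd_sqrt[OF T] by blast
  note [simp] = stiefelD[OF Q] stiefelD[OF G] psd_matsD(2-4)[OF S(1)]
  note gap = trace_gap[OF Q G S(1), unfolded S(2)]
  show "mat_trace (transpose_mat Q * (G * T)) \<le> mat_trace T"
    using gap mat_trace_gram_nonneg[of "(Q - G) * S"] by simp
  assume "mat_trace (transpose_mat Q * (G * T)) = mat_trace T"
  then have "(Q - G) * S = 0\<^sub>m n p"
    using gap mat_trace_gram_eq_0[of "(Q - G) * S"] by simp
  then have "(Q - G) * S * S = 0\<^sub>m n p" using psd_matsD(1)[OF S(1)] by simp
  then have "Q * T - G * T = 0\<^sub>m n p"
    by (simp add: mult_assoc_dim minus_mult_distrib_dim flip: S(2))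
  then have *: "(Q * T - G * T) $$ (i, j) = 0" if "i < n" "j < p" for i j using that by simp
  show "Q * T = G * T"
    using * psd_matsD(2,3)[OF T] by (intro eq_matI) auto
qed

section \<open>Rank and block forms\<close>

text \<open>A function replaces the list of \<open>rect_diag\<close>, so that one and the same
  \<open>s\<close> serves matrices of several shapes.\<close>

definition rdiag :: "nat \<Rightarrow> nat \<Rightarrow> (nat \<Rightarrow> real) \<Rightarrow> real mat" where
  "rdiag n p f = mat n p (\<lambda>(i, j). if i = j then f i else 0)"

lemma rdiag_dims [simp]: "dim_row (rdiag n p f) = n" "dim_col (rdiag n p f) = p"
  by (simp_all add: rdiag_def)

lemma rdiag_carrier [simp]: "rdiag n p f \<in> carrier_mat n p"
  by (simp add: rdiag_def)

lemma rdiag_cong: "(\<And>i. i < n \<Longrightarrow> i < p \<Longrightarrow> f i = g i) \<Longrightarrow> rdiag n p f = rdiag n p g"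
  by (intro eq_matI) (auto simp: rdiag_def)

lemma rdiag_mult: "rdiag n p f * rdiag p q g = rdiag n q (\<lambda>i. if i < p then f i * g i else 0)"
proof (intro eq_matI)
  fix i j assume "i < dim_row (rdiag n q (\<lambda>i. if i < p then f i * g i else 0))"
    "j < dim_col (rdiag n q (\<lambda>i. if i < p then f i * g i else 0))"
  then have ij: "i < n" "j < q" by simp_all
  have "(rdiag n p f * rdiag p q g) $$ (i, j) =
      (\<Sum>l<p. (if i = l then f i else 0) * (if l = j then g l else 0))"
    using ij by (simp add: rdiag_def scalar_prod_def atLeast0LessThan)
  also have "\<dots> = (\<Sum>l<p. if i = l then (if i = j then f i * g i else 0) else 0)"
    by (intro sum.cong) auto
  also have "\<dots> = rdiag n q (\<lambda>i. if i < p then f i * g i else 0) $$ (i, j)"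
    using ij by (simp add: rdiag_def)
  finally show "(rdiag n p f * rdiag p q g) $$ (i, j) =
      rdiag n q (\<lambda>i. if i < p then f i * g i else 0) $$ (i, j)" .
qed simp_all

lemma rdiag_square: "mat_diag n f = rdiag n n f"
  by (intro eq_matI) (auto simp: rdiag_def mat_diag_def)

lemma transpose_rdiag: "transpose_mat (rdiag n p f) = rdiag p n f"
  by (intro eq_matI) (auto simp: rdiag_def)

lemma rdiag_stiefel:
  assumes "p \<le> n"
  shows "rdiag n p (\<lambda>_. 1) \<in> stiefel n p"
proof -
  have "transpose_mat (rdiag n p (\<lambda>_. 1)) * rdiag n p (\<lambda>_. 1) = 1\<^sub>m p"
    unfolding transpose_rdiag rdiag_mult using assms by (intro eq_matI) (auto simp: rdiag_def)
  then show ?thesis by (simp add: stiefel_def)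
qed

section \<open>Rank and column spans\<close>

text \<open>Column \<open>j\<close> of the product is \<open>A\<close> applied to column
  \<open>j\<close> of \<open>B\<close>, a linear combination of the columns of
  \<open>A\<close>.\<close>

lemma span_cols_mult_subset:
  fixes A B :: "real mat"
  assumes A: "A \<in> carrier_mat n k" and B: "B \<in> carrier_mat k m"
  shows "LinearCombinations.module.span class_ring (module_vec TYPE(real) n) (set (cols (A * B)))
    \<subseteq> LinearCombinations.module.span class_ring (module_vec TYPE(real) n) (set (cols A))"
proof -
  interpret vec_space "TYPE(real)" n .
  have cA: "set (cols A) \<subseteq> carrier_vec n" using cols_dim[of A] A by simp
  have *: "col (A * B) j \<in> span (set (cols A))" if "j < m" for j
  proof -
    define c where "c = (\<lambda>i. B $$ (i, j))"
    have "col (A * B) j = A *\<^sub>v col B j" by (rule col_mult2[OF A B that])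
    also have "col B j = vec (length (cols A)) c"
      unfolding c_def by (rule eq_vecI) (use A B that in simp_all)
    also have "A *\<^sub>v vec (length (cols A)) c = lincomb_list c (cols A)"
    proof -
      have "\<forall>w\<in>set (cols A). dim_vec w = n" using cA by (meson carrier_vecD subsetD)
      moreover have "mat_of_cols n (cols A) = A" using A mat_of_cols_cols[of A] by simp
      ultimately show ?thesis using lincomb_list_as_mat_mult[of "cols A" c] by simp
    qed
    also have "\<dots> \<in> span_list (cols A)" unfolding span_list_def by blast
    finally show ?thesis unfolding span_list_as_span[OF cA] .
  qed
  have cAB: "set (cols (A * B)) = (\<lambda>j. col (A * B) j) ` {..<m}"
    using A B unfolding cols_def set_map by (simp add: atLeast0LessThan)
  have "set (cols (A * B)) \<subseteq> span (set (cols A))"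
    unfolding cAB image_subset_iff using * by simp
  then show ?thesis by (rule span_subsetI[OF cA])
qed

text \<open>Factoring each matrix through the other gives both inclusions between the column
  spans.\<close>

lemma rank_eq_of_factors:
  fixes A B :: "real mat"
  assumes "A \<in> carrier_mat n k" "C \<in> carrier_mat k m" "D \<in> carrier_mat m k" "B = A * C" "A = B * D"
  shows "vec_space.rank n A = vec_space.rank n B"
proof -
  interpret vec_space "TYPE(real)" n .
  have B: "B \<in> carrier_mat n m" unfolding assms(4) using assms(1,2) by (rule mult_carrier_mat)
  have "span (set (cols A)) = span (set (cols B))"
    using span_cols_mult_subset[OF assms(1,2), folded assms(4)]
      span_cols_mult_subset[OF B assms(3), folded assms(5)] by (rule subset_antisym[rotated])
  then show ?thesis by (simp add: rank_def)
qed

text \<open>The transpose is a left inverse, so the kernel is trivial and the columns are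
  independent.\<close>

lemma rank_stiefel:
  assumes Q: "Q \<in> stiefel n k"
  shows "vec_space.rank n Q = k"
proof -
  interpret vec_space "TYPE(real)" n .
  note [simp] = stiefelD(2,3)[OF Q]
  have inj: "v = 0\<^sub>v k" if "v \<in> carrier_vec k" "Q *\<^sub>v v = 0\<^sub>v n" for v
  proof -
    have "v = (transpose_mat Q * Q) *\<^sub>v v" using that stiefelD(4)[OF Q] by simp
    also have "\<dots> = transpose_mat Q *\<^sub>v (Q *\<^sub>v v)"
      using stiefelD(1)[OF Q] that by (intro assoc_mult_mat_vec) auto
    also have "\<dots> = 0\<^sub>v k" using that stiefelD(1)[OF Q] by (intro eq_vecI) auto
    finally show ?thesis .
  qed
  have ip: "scalar_prod (col Q i) (col Q j) = (if i = j then 1 else 0)" if "i < k" "j < k" for i j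
    using arg_cong[OF stiefelD(4)[OF Q], of "\<lambda>M. M $$ (i, j)"] that by simp
  \<comment> \<open>A set of columns merges equal ones, so distinctness is what makes it count
    \<open>k\<close> vectors.\<close>
  have d: "distinct (cols Q)"
  proof (unfold distinct_conv_nth, intro allI impI)
    fix i j assume "i < length (cols Q)" "j < length (cols Q)" "i \<noteq> j"
    then show "cols Q ! i \<noteq> cols Q ! j"
      using ip[of i i] ip[of i j] by auto
  qed
  have "lin_indpt (set (cols Q))"
    using lin_depE[OF stiefelD(1)[OF Q] _ d] inj by metis
  then show ?thesis using lin_indpt_full_rank[OF stiefelD(1)[OF Q] d] by simp
qed

text \<open>The product has the same column span as the first \<open>k\<close> columns of
  \<open>U\<close>, which are orthonormal.\<close>

lemma rank_svd:
  assumes U: "U \<in> orth_group n" and V: "V \<in> orth_group p" and k: "k \<le> p" "p \<le> n"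
    and s: "\<And>i. i < k \<Longrightarrow> s i \<noteq> 0" "\<And>i. k \<le> i \<Longrightarrow> s i = 0"
  shows "vec_space.rank n (U * rdiag n p s * transpose_mat V) = k"
proof -
  note [simp] = orth_groupD[OF U] orth_groupD[OF V]
  let ?E = "U * rdiag n k (\<lambda>_. 1)"
  have E: "?E \<in> stiefel n k"
    using stiefel_mult[of U n n "rdiag n k (\<lambda>_. 1)" k] U k rdiag_stiefel by (simp add: stiefel_square)
  have "U * rdiag n p s * transpose_mat V = ?E * (rdiag k p s * transpose_mat V)"
  proof -
    have "rdiag n k (\<lambda>_. 1) * rdiag k p s = rdiag n p s"
      unfolding rdiag_mult using s(2) by (intro rdiag_cong) auto
    then have "rdiag n k (\<lambda>_. 1) * (rdiag k p s * transpose_mat V) = rdiag n p s * transpose_mat V"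
      by (subst mult_assoc_dim[symmetric]) simp_all
    then show ?thesis by (simp add: mult_assoc_dim)
  qed
  \<comment> \<open>Dividing by the nonzero \<open>s i\<close> recovers the first \<open>k\<close>
    columns of \<open>U\<close>.\<close>
  moreover have "?E = (U * rdiag n p s * transpose_mat V) * (V * rdiag p k (\<lambda>i. 1 / s i))"
  proof -
    have "rdiag n p s * rdiag p k (\<lambda>i. 1 / s i) = rdiag n k (\<lambda>_. 1)"
      unfolding rdiag_mult using s(1) k by (intro rdiag_cong) auto
    then show ?thesis by (simp add: mult_assoc_dim)
  qed
  moreover have "rdiag k p s * transpose_mat V \<in> carrier_mat k p"
    "V * rdiag p k (\<lambda>i. 1 / s i) \<in> carrier_mat p k"
    by (rule carrier_matI; simp)+
  ultimately have "vec_space.rank n (U * rdiag n p s * transpose_mat V) = vec_space.rank n ?E"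
    using rank_eq_of_factors[OF stiefelD(1)[OF E]] by metis
  then show ?thesis using rank_stiefel[OF E] by simp
qed

lemma singular_values_properties:
  assumes X: "X \<in> carrier_mat n p"
  shows "length (singular_values X) = p" "\<And>x. x \<in> set (singular_values X) \<Longrightarrow> x \<ge> 0"
    "sorted_wrt (\<ge>) (singular_values X)"
proof -
  have "transpose_mat X * X \<in> psd_mats p"
    using psd_mats_congruence[OF mat_diag_psd[of n "\<lambda>_. 1"] X] X by simp
  then obtain W d where W: "W \<in> orth_group p" and d: "\<forall>i<p. d i \<ge> 0"
    and XW: "transpose_mat X * X = W * mat_diag p d * transpose_mat W"
    using psd_spectral by blast
  have "mat_diag p d = mat_diag p (\<lambda>i. sqrt (d i) * sqrt (d i))"
    using d by (intro mat_diag_cong) auto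
  then have sv: "singular_values X = rev (sort (map (\<lambda>i. sqrt (d i)) [0..<p]))"
    using singular_values_eq[OF W, of "\<lambda>i. sqrt (d i)" X] d XW by simp
  then show "length (singular_values X) = p" "\<And>x. x \<in> set (singular_values X) \<Longrightarrow> x \<ge> 0"
    using d by auto
  show "sorted_wrt (\<ge>) (singular_values X)"
    unfolding sv by (simp add: sorted_wrt_rev)
qed

text \<open>For a list of singular values, \<open>rank_svd\<close> later identifies this
  \<open>k\<close> with the rank.\<close>

lemma nonincreasing_positive_prefix:
  fixes xs :: "real list"
  assumes "sorted_wrt (\<ge>) xs" "\<And>x. x \<in> set xs \<Longrightarrow> x \<ge> 0"
  obtains k where "k \<le> length xs" "\<And>i. i < k \<Longrightarrow> xs ! i > 0"
    "\<And>i. k \<le> i \<Longrightarrow> i < length xs \<Longrightarrow> xs ! i = 0"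
proof
  let ?k = "length (takeWhile (\<lambda>x. x > 0) xs)"
  show "?k \<le> length xs" by (rule length_takeWhile_le)
  show "xs ! i > 0" if "i < ?k" for i
    using that by (metis nth_mem set_takeWhileD takeWhile_nth)
  show "xs ! i = 0" if "?k \<le> i" "i < length xs" for i
  proof -
    have "\<not> xs ! ?k > 0" using that nth_length_takeWhile[of "\<lambda>x. x > 0" xs] by simp
    moreover have "xs ! i \<le> xs ! ?k"
      using that assms(1) by (cases "i = ?k") (auto simp: sorted_wrt_iff_nth_less)
    moreover have "xs ! i \<ge> 0" using that assms(2) by simp
    ultimately show ?thesis by linarith
  qed
qed

section \<open>Block matrices with a leading identity\<close>

lemma block_id_dims [simp]:
  "dim_row (block_id k B) = k + dim_row B" "dim_col (block_id k B) = k + dim_col B"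
  by (simp_all add: block_id_def)

lemma block_id_index:
  "i < k + dim_row B \<Longrightarrow> j < k + dim_col B \<Longrightarrow> block_id k B $$ (i, j) =
    (if i < k \<or> j < k then (if i = j then 1 else 0) else B $$ (i - k, j - k))"
  by (auto simp: block_id_def)

lemma transpose_block_id: "transpose_mat (block_id k B) = block_id k (transpose_mat B)"
  by (intro eq_matI) (auto simp: block_id_index)

lemma block_id_mult:
  assumes "dim_col A = dim_row B"
  shows "block_id k A * block_id k B = block_id k (A * B)"
  unfolding block_id_def using assms
  by (subst mult_four_block_mat[of _ k k _ "dim_col A" _ "dim_row A" _ _ k _ "dim_col B"]) auto

lemma block_id_one: "block_id k (1\<^sub>m m) = 1\<^sub>m (k + m)"
  by (intro eq_matI) (auto simp: block_id_index)

lemma block_id_inject: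
  assumes "block_id k A = block_id k B"
  shows "A = B"
proof (rule eq_matI)
  show d: "dim_row A = dim_row B" "dim_col A = dim_col B"
    using arg_cong[OF assms, of dim_row] arg_cong[OF assms, of dim_col] by simp_all
  fix i j assume "i < dim_row B" "j < dim_col B"
  then show "A $$ (i, j) = B $$ (i, j)"
    using arg_cong[OF assms, of "\<lambda>M. M $$ (k + i, k + j)"] d by (simp add: block_id_index)
qed

text \<open>The Gram matrix is computed blockwise. One direction extracts \<open>R\<close> in
  \<open>stiefel_block_form\<close>, the other builds the polar factor in
  \<open>mat_diag_block_form\<close>.\<close>

lemma block_id_stiefel_iff: "block_id k R \<in> stiefel (k + n) (k + p) \<longleftrightarrow> R \<in> stiefel n p"
proof -
  have "block_id k R \<in> carrier_mat (k + n) (k + p) \<longleftrightarrow> R \<in> carrier_mat n p"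
    unfolding carrier_mat_def by simp
  moreover have "transpose_mat (block_id k R) * block_id k R = 1\<^sub>m (k + p) \<longleftrightarrow>
      transpose_mat R * R = 1\<^sub>m p"
    unfolding transpose_block_id block_id_one[symmetric]
    using block_id_inject[of k "transpose_mat R * R" "1\<^sub>m p"] by (auto simp: block_id_mult)
  ultimately show ?thesis unfolding stiefel_def mem_Collect_eq by (rule conj_cong)
qed

text \<open>Row scaling by \<open>s\<close> wipes out all rows from \<open>k\<close> on, hence the
  whole block \<open>R\<close>.\<close>

lemma mat_diag_mult_block_id:
  assumes s: "\<And>i. k \<le> i \<Longrightarrow> s i = 0" and R: "R \<in> carrier_mat n p"
  shows "mat_diag (k + n) s * block_id k R = rdiag (k + n) (k + p) s"
proof -
  have "block_id k R \<in> carrier_mat (k + n) (k + p)" using R by (intro carrier_matI) auto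
  then have "mat_diag (k + n) s * block_id k R =
      mat (k + n) (k + p) (\<lambda>(i, j). s i * block_id k R $$ (i, j))"
    by (rule mat_diag_mult_left)
  also have "\<dots> = rdiag (k + n) (k + p) s"
  proof (rule eq_matI)
    fix i j assume ij: "i < dim_row (rdiag (k + n) (k + p) s)" "j < dim_col (rdiag (k + n) (k + p) s)"
    show "mat (k + n) (k + p) (\<lambda>(i, j). s i * block_id k R $$ (i, j)) $$ (i, j) =
        rdiag (k + n) (k + p) s $$ (i, j)"
    proof (cases "i < k")
      case True
      then show ?thesis using ij R by (simp add: rdiag_def block_id_index)
    next
      case False
      then have "s i = 0" using s[of i] by simp
      then show ?thesis using ij by (auto simp: rdiag_def)
    qed
  qed simp_all
  finally show ?thesis .
qed

text \<open>Cancelling the nonzero \<open>s j\<close> shows that the first \<open>k\<close> columns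
  are unit vectors. The other columns are orthogonal to them, so their first \<open>k\<close>
  entries vanish.\<close>

lemma stiefel_block_form:
  assumes Q: "Q \<in> stiefel n p" and k: "k \<le> p" "p \<le> n"
    and s: "\<And>i. i < k \<Longrightarrow> s i \<noteq> 0" and eq: "Q * mat_diag p s = rdiag n p s"
  shows "\<exists>R\<in>stiefel (n - k) (p - k). Q = block_id k R"
proof -
  note [simp] = stiefelD(2,3)[OF Q]
  have "Q $$ (i, j) * s j = (if i = j then s i else 0)" if "i < n" "j < p" for i j
    using arg_cong[OF eq, of "\<lambda>M. M $$ (i, j)"] that stiefelD(1)[OF Q]
    by (simp add: mat_diag_mult_right rdiag_def)
  then have "Q $$ (i, j) * s j = (if i = j then s j else 0)" "s j \<noteq> 0" if "i < n" "j < k" for i j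
    using that k s[of j] by simp_all
  then have Q1: "Q $$ (i, j) = (if i = j then 1 else 0)" if "i < n" "j < k" for i j
    using that by (metis mult_cancel_right1 mult_eq_0_iff)
  \<comment> \<open>Column \<open>i\<close> is a unit vector, so its inner product with column
    \<open>j\<close> is just this entry.\<close>
  have Q2: "Q $$ (i, j) = 0" if "i < k" "k \<le> j" "j < p" for i j
  proof -
    have "0 = (transpose_mat Q * Q) $$ (i, j)" using that k stiefelD(4)[OF Q] by simp
    also have "\<dots> = (\<Sum>l<n. Q $$ (l, i) * Q $$ (l, j))"
      using that k by (simp add: scalar_prod_def atLeast0LessThan)
    also have "\<dots> = (\<Sum>l<n. if l = i then Q $$ (i, j) else 0)"
      using that k by (intro sum.cong) (auto simp: Q1)
    also have "\<dots> = Q $$ (i, j)" using that k by simp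
    finally show ?thesis by simp
  qed
  have Q3: "Q $$ (i, j) = 0" if "i < k" "j < p" "i \<noteq> j" for i j
    using Q1[of i j] Q2[of i j] that k by (cases "j < k") auto
  define R where "R = mat (n - k) (p - k) (\<lambda>(i, j). Q $$ (i + k, j + k))"
  have QR: "Q = block_id k R"
    using k by (intro eq_matI) (auto simp: R_def block_id_index Q1 Q3)
  then have "block_id k R \<in> stiefel (k + (n - k)) (k + (p - k))" using Q k by simp
  then have "R \<in> stiefel (n - k) (p - k)" by (simp only: block_id_stiefel_iff)
  then show ?thesis using QR by blast
qed

section \<open>Perturbation and common polar factors\<close>

lemma quadratic_form_sum:
  fixes B :: "real mat"
  assumes "B \<in> carrier_mat n n" "v \<in> carrier_vec n"
  shows "scalar_prod v (B *\<^sub>v v) = (\<Sum>i<n. \<Sum>j<n. B $$ (i, j) * (v $ i * v $ j))"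
proof -
  have "(B *\<^sub>v v) $ i = (\<Sum>j<n. B $$ (i, j) * v $ j)" if "i < n" for i
    using assms that by (simp add: scalar_prod_def atLeast0LessThan)
  then have "scalar_prod v (B *\<^sub>v v) = (\<Sum>i<n. v $ i * (\<Sum>j<n. B $$ (i, j) * v $ j))"
    using assms by (simp add: scalar_prod_def[of v] atLeast0LessThan del: index_mult_mat_vec)
  then show ?thesis by (simp add: sum_distrib_left mult_ac)
qed

text \<open>A crude bound suffices, but its right side may involve only the first \<open>k\<close>
  coordinates: those are the ones in which the diagonal matrix of \<open>psd_perturbation\<close> is
  positive.\<close>

lemma quadratic_form_le:
  fixes B :: "real mat"
  assumes B: "B \<in> carrier_mat n n" and v: "v \<in> carrier_vec n" and k: "k \<le> n"
    and B0: "\<And>i j. i < n \<Longrightarrow> j < n \<Longrightarrow> \<not> (i < k \<and> j < k) \<Longrightarrow> B $$ (i, j) = 0"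
  shows "scalar_prod v (B *\<^sub>v v) \<le> (\<Sum>i<n. \<Sum>j<n. \<bar>B $$ (i, j)\<bar>) * (\<Sum>i<k. (v $ i)\<^sup>2)"
proof -
  have *: "B $$ (i, j) * (v $ i * v $ j) \<le> \<bar>B $$ (i, j)\<bar> * (\<Sum>i<k. (v $ i)\<^sup>2)"
    if ij: "i < n" "j < n" for i j
  proof (cases "i < k \<and> j < k")
    case True
    have i: "(v $ i)\<^sup>2 \<le> (\<Sum>i<k. (v $ i)\<^sup>2)" and j: "(v $ j)\<^sup>2 \<le> (\<Sum>i<k. (v $ i)\<^sup>2)"
      using True by (auto intro!: member_le_sum)
    have "2 * \<bar>v $ i\<bar> * \<bar>v $ j\<bar> \<le> (v $ i)\<^sup>2 + (v $ j)\<^sup>2"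
      using sum_squares_bound[of "\<bar>v $ i\<bar>" "\<bar>v $ j\<bar>"] by simp
    then have "\<bar>v $ i * v $ j\<bar> \<le> (\<Sum>i<k. (v $ i)\<^sup>2)"
      using i j unfolding abs_mult by linarith
    then have "\<bar>B $$ (i, j)\<bar> * \<bar>v $ i * v $ j\<bar> \<le> \<bar>B $$ (i, j)\<bar> * (\<Sum>i<k. (v $ i)\<^sup>2)"
      by (intro mult_left_mono) auto
    then show ?thesis using abs_ge_self[of "B $$ (i, j) * (v $ i * v $ j)"]
      unfolding abs_mult by linarith
  next
    case False
    then show ?thesis using B0[OF ij] by simp
  qed
  have "scalar_prod v (B *\<^sub>v v) \<le> (\<Sum>i<n. \<Sum>j<n. \<bar>B $$ (i, j)\<bar> * (\<Sum>i<k. (v $ i)\<^sup>2))"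
    unfolding quadratic_form_sum[OF B v] by (intro sum_mono *) simp_all
  then show ?thesis by (simp add: sum_distrib_right)
qed

lemma block_pd_matsD:
  assumes "S \<in> block_pd_mats n k" "k \<le> n"
  shows "S \<in> psd_mats n"
    and "\<And>i j. i < n \<Longrightarrow> j < n \<Longrightarrow> \<not> (i < k \<and> j < k) \<Longrightarrow> S $$ (i, j) = 0"
proof -
  obtain A where S: "S = four_block_mat A (0\<^sub>m k (n - k)) (0\<^sub>m (n - k) k) (0\<^sub>m (n - k) (n - k))"
    and A: "A \<in> carrier_mat k k"
    using assms by (auto simp: block_pd_mats_def pd_mats_def)
  show "S $$ (i, j) = 0" if "i < n" "j < n" "\<not> (i < k \<and> j < k)" for i j
    unfolding S using A that by (subst index_mat_four_block(1)) auto
  show "S \<in> psd_mats n" using assms by (simp add: block_pd_mats_def)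
qed

text \<open>Makes the diagonal matrix of singular values an admissible \<open>S\<close> in
  \<open>W_set\<close>.\<close>

lemma mat_diag_block_pd:
  assumes "k \<le> n" and s: "\<And>i. i < k \<Longrightarrow> s i > 0" "\<And>i. k \<le> i \<Longrightarrow> s i = 0"
  shows "mat_diag n s \<in> block_pd_mats n k"
proof -
  have "scalar_prod v (mat_diag k s *\<^sub>v v) > 0" if v: "v \<in> carrier_vec k" "v \<noteq> 0\<^sub>v k" for v
  proof -
    obtain i where i: "i < k" "v $ i \<noteq> 0" using v by (metis carrier_vecD eq_vecI index_zero_vec)
    show ?thesis unfolding mat_diag_quadratic_form[OF v(1)]
      by (rule sum_pos2[of _ i]) (use i s(1) in \<open>auto simp: less_imp_le\<close>)
  qed
  then have "mat_diag k s \<in> pd_mats k" by (simp add: pd_mats_def)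
  moreover have "mat_diag n s =
      four_block_mat (mat_diag k s) (0\<^sub>m k (n - k)) (0\<^sub>m (n - k) k) (0\<^sub>m (n - k) (n - k))"
    by (rule eq_matI) (use assms(1) s(2) in \<open>auto simp: mat_diag_def not_less\<close>)
  moreover have "mat_diag n s \<in> psd_mats n"
  proof (rule mat_diag_psd)
    show "s i \<ge> 0" for i using s[of i] by (cases "i < k") (auto simp: less_imp_le)
  qed
  ultimately show ?thesis unfolding block_pd_mats_def by blast
qed

text \<open>\<open>P\<close> only helps. \<open>S\<close> lives on the leading block, where the
  smallest diagonal entry dominates \<open>t\<close> times its quadratic form for small
  \<open>t\<close>.\<close>

lemma psd_perturbation:
  assumes k: "k \<le> n" and s: "\<And>i. i < k \<Longrightarrow> s i > 0" "\<And>i. k \<le> i \<Longrightarrow> s i = 0"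
    and P: "P \<in> psd_mats n" and S: "S \<in> block_pd_mats n k"
  shows "\<exists>e>0. \<forall>t. 0 \<le> t \<longrightarrow> t \<le> e \<longrightarrow> mat_diag n s + t \<cdot>\<^sub>m (P - S) \<in> psd_mats n"
proof -
  note Sp = block_pd_matsD(1)[OF S k]
  note [simp] = psd_matsD(2-4)[OF P] psd_matsD(2-4)[OF Sp]
  define C where "C = (\<Sum>i<n. \<Sum>j<n. \<bar>S $$ (i, j)\<bar>)"
  have C: "C \<ge> 0" unfolding C_def by (intro sum_nonneg) auto
  \<comment> \<open>Inserting 1 keeps the set nonempty when \<open>k = 0\<close>.\<close>
  define m where "m = Min (insert 1 (s ` {..<k}))"
  have m: "m > 0" unfolding m_def using s(1) by (subst Min_gr_iff) auto
  have ms: "m \<le> s i" if "i < k" for i unfolding m_def using that by (intro Min_le) auto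
  \<comment> \<open>The denominator is \<open>C + 1\<close> because \<open>C\<close> is zero for
    \<open>S = 0\<close>.\<close>
  have *: "scalar_prod v ((mat_diag n s + t \<cdot>\<^sub>m (P - S)) *\<^sub>v v) \<ge> 0"
    if v: "v \<in> carrier_vec n" and t: "0 \<le> t" "t \<le> m / (C + 1)" for v t
  proof -
    let ?q = "\<Sum>i<k. (v $ i)\<^sup>2"
    have q: "?q \<ge> 0" by (simp add: sum_nonneg)
    have "mat_diag n s + t \<cdot>\<^sub>m (P - S) \<in> carrier_mat n n" by (rule carrier_matI) simp_all
    from quadratic_form_sum[OF this v]
    have "scalar_prod v ((mat_diag n s + t \<cdot>\<^sub>m (P - S)) *\<^sub>v v) =
      (\<Sum>i<n. \<Sum>j<n. mat_diag n s $$ (i, j) * (v $ i * v $ j) +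
         (t * (P $$ (i, j) * (v $ i * v $ j)) - t * (S $$ (i, j) * (v $ i * v $ j))))"
      by (simp add: algebra_simps)
    also have "\<dots> = scalar_prod v (mat_diag n s *\<^sub>v v) +
        (t * scalar_prod v (P *\<^sub>v v) - t * scalar_prod v (S *\<^sub>v v))"
      using psd_matsD(1)[OF P] psd_matsD(1)[OF Sp] v
      by (simp add: quadratic_form_sum[of _ n] sum.distrib sum_subtractf sum_distrib_left)
    finally have eq: "scalar_prod v ((mat_diag n s + t \<cdot>\<^sub>m (P - S)) *\<^sub>v v) =
        scalar_prod v (mat_diag n s *\<^sub>v v) +
        (t * scalar_prod v (P *\<^sub>v v) - t * scalar_prod v (S *\<^sub>v v))" .
    have "m * ?q = (\<Sum>i<k. m * (v $ i)\<^sup>2)" by (simp add: sum_distrib_left)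
    also have "\<dots> \<le> (\<Sum>i<k. s i * (v $ i)\<^sup>2)" using ms by (intro sum_mono mult_right_mono) auto
    also have "\<dots> = (\<Sum>i<n. s i * (v $ i)\<^sup>2)"
      using k s(2) by (intro sum.mono_neutral_left) auto
    also have "\<dots> = scalar_prod v (mat_diag n s *\<^sub>v v)" using mat_diag_quadratic_form[OF v] by simp
    finally have 1: "m * ?q \<le> scalar_prod v (mat_diag n s *\<^sub>v v)" .
    have "t * scalar_prod v (S *\<^sub>v v) \<le> t * (C * ?q)"
      using quadratic_form_le[OF psd_matsD(1)[OF Sp] v k block_pd_matsD(2)[OF S k]] t
      unfolding C_def by (intro mult_left_mono) auto
    also have "\<dots> \<le> m / (C + 1) * ((C + 1) * ?q)"
      using t q C m by (intro mult_mono) (auto intro!: mult_right_mono)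
    also have "\<dots> = m * ?q" using C by simp
    finally have 2: "t * scalar_prod v (S *\<^sub>v v) \<le> m * ?q" .
    have 3: "t * scalar_prod v (P *\<^sub>v v) \<ge> 0" using psd_matsD(5)[OF P v] t by simp
    show ?thesis unfolding eq using 1 2 3 by linarith
  qed
  have "transpose_mat (mat_diag n s + t \<cdot>\<^sub>m (P - S)) = mat_diag n s + t \<cdot>\<^sub>m (P - S)" for t
  proof -
    have PS: "P $$ (j, i) = P $$ (i, j)" "S $$ (j, i) = S $$ (i, j)" if "i < n" "j < n" for i j
      using that arg_cong[OF psd_matsD(4)[OF P], of "\<lambda>M. M $$ (i, j)"]
        arg_cong[OF psd_matsD(4)[OF Sp], of "\<lambda>M. M $$ (i, j)"]
      by (simp_all del: psd_matsD(4)[OF P] psd_matsD(4)[OF Sp])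
    show ?thesis by (rule eq_matI) (auto simp: PS, auto simp: mat_diag_def)
  qed
  moreover have "mat_diag n s + t \<cdot>\<^sub>m (P - S) \<in> carrier_mat n n" for t
    by (rule carrier_matI) simp_all
  ultimately have "\<forall>t. 0 \<le> t \<longrightarrow> t \<le> m / (C + 1) \<longrightarrow> mat_diag n s + t \<cdot>\<^sub>m (P - S) \<in> psd_mats n"
    using * unfolding psd_mats_def by blast
  moreover have "m / (C + 1) > 0" using m C by simp
  ultimately show ?thesis by blast
qed

section \<open>Common polar factors\<close>

lemma mat_trace_orth_conj:
  assumes V: "V \<in> orth_group p" and K: "K \<in> carrier_mat p p"
  shows "mat_trace (V * K * transpose_mat V) = mat_trace K"
proof -
  note [simp] = orth_groupD[OF V] carrier_matD[OF K]
  have "mat_trace (V * K * transpose_mat V) = mat_trace (transpose_mat V * (V * K))"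
    by (rule mat_trace_mult_comm) simp_all
  then show ?thesis by simp
qed

text \<open>\<open>Q\<close> comes from the midpoint. Its trace pairing is linear and at most the
  nuclear norm at either end; the midpoint attains the average of the two bounds, so both hold with
  equality.\<close>

lemma common_polar_factor:
  assumes pn: "p \<le> n" and G: "G \<in> stiefel n p" and T: "T \<in> psd_mats p" and Y: "Y \<in> carrier_mat n p"
    and YX: "nuclear_norm Y = nuclear_norm (G * T)"
    and mid: "nuclear_norm ((1 / 2) \<cdot>\<^sub>m (G * T) + (1 / 2) \<cdot>\<^sub>m Y) = nuclear_norm (G * T)"
  shows "\<exists>Q\<in>stiefel n p. \<exists>T'\<in>psd_mats p. G * T = Q * T \<and> Y = Q * T'"
proof -
  note [simp] = stiefelD(2,3)[OF G] psd_matsD(2,3)[OF T] carrier_matD[OF Y]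
  have Z: "(1 / 2) \<cdot>\<^sub>m (G * T) + (1 / 2) \<cdot>\<^sub>m Y \<in> carrier_mat n p" by (rule carrier_matI) simp_all
  obtain Q K where Q: "Q \<in> stiefel n p" and K: "K \<in> psd_mats p"
    and ZQ: "(1 / 2) \<cdot>\<^sub>m (G * T) + (1 / 2) \<cdot>\<^sub>m Y = Q * K"
    using polar_decomposition[OF Z pn] by blast
  obtain G' T' where G': "G' \<in> stiefel n p" and T': "T' \<in> psd_mats p" and YG: "Y = G' * T'"
    using polar_decomposition[OF Y pn] by blast
  note [simp] = stiefelD[OF Q] psd_matsD(2,3)[OF K]
  note nX = nuclear_norm_polar[OF G T]
  have nY: "mat_trace T' = mat_trace T" using YX nX nuclear_norm_polar[OF G' T'] YG by simp
  have nZ: "mat_trace K = mat_trace T" using mid nX nuclear_norm_polar[OF Q K] ZQ by simp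
  have "K = transpose_mat Q * (Q * K)" by simp
  also have "\<dots> = (1 / 2) \<cdot>\<^sub>m (transpose_mat Q * (G * T)) + (1 / 2) \<cdot>\<^sub>m (transpose_mat Q * Y)"
    unfolding ZQ[symmetric] by (simp add: mult_add_distrib_dim smult_mult_dim)
  finally have "mat_trace K = (1 / 2) * mat_trace (transpose_mat Q * (G * T)) +
      (1 / 2) * mat_trace (transpose_mat Q * Y)"
    by (simp add: mat_trace_add mat_trace_smult)
  moreover have "mat_trace (transpose_mat Q * (G * T)) \<le> mat_trace T"
    by (rule trace_le_nuclear_norm(1)[OF Q G T])
  moreover have "mat_trace (transpose_mat Q * Y) \<le> mat_trace T'"
    unfolding YG by (rule trace_le_nuclear_norm(1)[OF Q G' T'])
  ultimately have "mat_trace (transpose_mat Q * (G * T)) = mat_trace T"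
    "mat_trace (transpose_mat Q * Y) = mat_trace T'"
    using nY nZ by linarith+
  then have "Q * T = G * T" "Q * T' = Y"
    using trace_le_nuclear_norm(2)[OF Q G T] trace_le_nuclear_norm(2)[OF Q G' T'] YG by auto
  then show ?thesis using Q T' by metis
qed

section \<open>Segments and the direction set\<close>

text \<open>\<open>NQ\<close> confines the symmetric \<open>N\<close> to the range of
  \<open>Q\<close>, so the product has the polar factor \<open>U * Q * transpose_mat V\<close> and
  the semidefinite factor \<open>T\<close>, a compression of \<open>N\<close> with the same
  trace.\<close>

lemma nuclear_norm_svd_psd:
  assumes U: "U \<in> orth_group n" and V: "V \<in> orth_group p" and Q: "Q \<in> stiefel n p"
    and N: "N \<in> psd_mats n" and NQ: "N * (Q * transpose_mat Q) = N"
  shows "nuclear_norm (U * N * Q * transpose_mat V) = mat_trace N"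
proof -
  note [simp] = orth_groupD[OF U] orth_groupD[OF V] stiefelD[OF Q] psd_matsD(2-4)[OF N]
  define T where "T = transpose_mat (Q * transpose_mat V) * N * (Q * transpose_mat V)"
  have G: "U * Q * transpose_mat V \<in> stiefel n p"
    using stiefel_mult[OF stiefel_mult[of U n n Q p] , of "transpose_mat V" p] U Q
      orth_group_transpose[OF V] by (simp add: stiefel_square)
  have QV: "Q * transpose_mat V \<in> carrier_mat n p" by (rule carrier_matI) simp_all
  have T: "T \<in> psd_mats p" unfolding T_def by (rule psd_mats_congruence[OF N QV])
  \<comment> \<open>Transposing \<open>NQ\<close> moves the projection to the left of the symmetric
    \<open>N\<close>.\<close>
  have "Q * (transpose_mat Q * N) = N"
    using arg_cong[OF NQ, of transpose_mat] by (simp add: transpose_mult_dim mult_assoc_dim)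
  then have QN: "Q * (transpose_mat Q * (N * Z)) = N * Z" if "dim_row Z = n" for Z
    using that by (simp flip: mult_assoc_dim)
  have "U * Q * transpose_mat V * T = U * N * Q * transpose_mat V"
    by (simp add: T_def mult_assoc_dim transpose_mult_dim QN)
  then have "nuclear_norm (U * N * Q * transpose_mat V) = mat_trace T"
    using nuclear_norm_polar[OF G T] by simp
  also have "T = V * (transpose_mat Q * (N * Q)) * transpose_mat V"
    by (simp add: T_def mult_assoc_dim transpose_mult_dim)
  also have "mat_trace \<dots> = mat_trace (transpose_mat Q * (N * Q))"
    by (rule mat_trace_orth_conj[OF V]) (rule carrier_matI, simp_all)
  also have "\<dots> = mat_trace (N * (Q * transpose_mat Q))"
    by (subst mat_trace_mult_comm) (simp_all add: mult_assoc_dim)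
  finally show ?thesis unfolding NQ .
qed

text \<open>\<open>szero\<close> reaches beyond \<open>p\<close>, so that the square matrix
  \<open>mat_diag n s\<close> also carries only the positive singular values.\<close>

locale svd =
  fixes n p k :: nat and U V X :: "real mat" and s :: "nat \<Rightarrow> real"
  assumes kp: "k \<le> p" and pn: "p \<le> n"
    and U: "U \<in> orth_group n" and V: "V \<in> orth_group p"
    and spos: "\<And>i. i < k \<Longrightarrow> s i > 0" and szero: "\<And>i. k \<le> i \<Longrightarrow> s i = 0"
    and X: "X = U * rdiag n p s * transpose_mat V"
begin

lemma dims [simp]:
  "dim_row U = n" "dim_col U = n" "dim_row V = p" "dim_col V = p" "dim_row X = n" "dim_col X = p"
  using orth_groupD[OF U] orth_groupD[OF V] by (simp_all add: X)

text \<open>The decomposition of \<open>X\<close> can thus be written with a square semidefinite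
  middle factor and any block matrix \<open>block_id k R\<close>, since the diagonal does not see
  \<open>R\<close>.\<close>

lemma mat_diag_block_form:
  assumes R: "R \<in> stiefel (n - k) (p - k)"
  shows "block_id k R \<in> stiefel n p"
    and "mat_diag n s * block_id k R = rdiag n p s"
    and "block_id k (R * transpose_mat R) = block_id k R * transpose_mat (block_id k R)"
    and "mat_diag n s * (block_id k R * transpose_mat (block_id k R)) = mat_diag n s"
proof -
  note [simp] = stiefelD(2,3)[OF R]
  have kn: "k + (n - k) = n" "k + (p - k) = p" using kp pn by simp_all
  show "block_id k R \<in> stiefel n p" using block_id_stiefel_iff[of k R "n - k" "p - k"] R by (simp add: kn)
  show "mat_diag n s * block_id k R = rdiag n p s"
    using mat_diag_mult_block_id[of k s, OF szero stiefelD(1)[OF R]] by (simp add: kn)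
  show eq: "block_id k (R * transpose_mat R) = block_id k R * transpose_mat (block_id k R)"
    by (simp add: transpose_block_id block_id_mult)
  have "R * transpose_mat R \<in> carrier_mat (n - k) (n - k)" by (rule carrier_matI) simp_all
  from mat_diag_mult_block_id[of k s, OF szero this]
  show "mat_diag n s * (block_id k R * transpose_mat (block_id k R)) = mat_diag n s"
    by (simp add: kn eq rdiag_square)
qed

text \<open>For negative \<open>t\<close> the summand \<open>t P\<close> may destroy positive
  semidefiniteness, hence the one-sided range; a segment that ends in \<open>X\<close> is
  enough.\<close>

lemma W_set_direction:
  assumes "H \<in> W_set n p k U V"
  shows "\<exists>e>0. \<forall>t. 0 \<le> t \<longrightarrow> t \<le> e \<longrightarrow> nuclear_norm (X + t \<cdot>\<^sub>m H) = nuclear_norm X"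
proof -
  obtain M R P S where H: "H = U * M * block_id k R * transpose_mat V"
    and P: "P \<in> psd_mats n" and S: "S \<in> block_pd_mats n k" and M: "M = P - S"
    and tr: "mat_trace M = 0" and R: "R \<in> stiefel (n - k) (p - k)"
    and MR: "M * block_id k (R * transpose_mat R) = M"
    using assms unfolding W_set_def by blast
  have kn: "k \<le> n" using kp pn by simp
  define Q where "Q = block_id k R"
  note form = mat_diag_block_form[OF R, folded Q_def]
  note [simp] = stiefelD(2,3)[OF form(1)] psd_matsD(2,3)[OF P]
    psd_matsD(2,3)[OF block_pd_matsD(1)[OF S kn]]
  have [simp]: "dim_row M = n" "dim_col M = n" by (simp_all add: M)
  have MQ: "M * (Q * transpose_mat Q) = M" using MR form(3) by simp
  \<comment> \<open>Gives \<open>X\<close> the same outer factors as \<open>H\<close>, so that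
    moving along \<open>H\<close> changes only the middle factor.\<close>
  have XQ: "X = U * mat_diag n s * Q * transpose_mat V"
    unfolding X form(2)[symmetric] by (simp add: mult_assoc_dim)
  have eq: "X + t \<cdot>\<^sub>m H = U * (mat_diag n s + t \<cdot>\<^sub>m M) * Q * transpose_mat V" for t
    unfolding XQ H Q_def[symmetric]
    by (simp add: mult_add_distrib_dim add_mult_distrib_dim smult_mult_dim)
  obtain e where e: "e > 0" "\<And>t. 0 \<le> t \<Longrightarrow> t \<le> e \<Longrightarrow> mat_diag n s + t \<cdot>\<^sub>m M \<in> psd_mats n"
    using psd_perturbation[of k n s, OF kn spos szero P S] unfolding M by blast
  have NQ: "(mat_diag n s + t \<cdot>\<^sub>m M) * (Q * transpose_mat Q) = mat_diag n s + t \<cdot>\<^sub>m M" for t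
    by (simp add: add_mult_distrib_dim smult_mult_dim MQ form(4))
  have nn: "nuclear_norm (X + t \<cdot>\<^sub>m H) = mat_trace (mat_diag n s)" if "0 \<le> t" "t \<le> e" for t
    unfolding eq nuclear_norm_svd_psd[OF U V form(1) e(2)[OF that] NQ]
    by (simp add: mat_trace_add mat_trace_smult tr)
  have "nuclear_norm X = mat_trace (mat_diag n s)"
    unfolding XQ
    by (rule nuclear_norm_svd_psd[OF U V form(1) _ form(4)])
      (rule block_pd_matsD(1)[OF mat_diag_block_pd[of k n s, OF kn spos szero] kn])
  then show ?thesis using e(1) nn by auto
qed

text \<open>In singular coordinates the common polar factor becomes \<open>K\<close>, which has
  block form because it maps one diagonal to the other. Then \<open>P\<close> comes from the
  semidefinite factor of \<open>Y\<close>, and \<open>S\<close> is the diagonal of singular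
  values.\<close>

lemma W_set_of_segment:
  assumes Y: "Y \<in> carrier_mat n p" and YX: "nuclear_norm Y = nuclear_norm X"
    and mid: "nuclear_norm ((1 / 2) \<cdot>\<^sub>m X + (1 / 2) \<cdot>\<^sub>m Y) = nuclear_norm X"
  shows "Y - X \<in> W_set n p k U V"
proof -
  note [simp] = orth_groupD(4-7)[OF U] orth_groupD(4-7)[OF V]
  have kn: "k \<le> n" using kp pn by simp
  define D where "D = mat_diag p s"
  \<comment> \<open>\<open>G\<close> and \<open>T\<close> form a polar decomposition of
    \<open>X\<close> read off its singular value decomposition.\<close>
  define G where "G = U * rdiag n p (\<lambda>_. 1) * transpose_mat V"
  define T where "T = V * D * transpose_mat V"
  have [simp]: "dim_row D = p" "dim_col D = p" by (simp_all add: D_def)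
  have G: "G \<in> stiefel n p" unfolding G_def
    using stiefel_mult[OF stiefel_mult[of U n n "rdiag n p (\<lambda>_. 1)" p], of "transpose_mat V" p] U
      rdiag_stiefel[OF pn] orth_group_transpose[OF V] by (simp add: stiefel_square)
  have s0: "s i \<ge> 0" for i using spos[of i] szero[of i] by (cases "i < k") (auto simp: less_imp_le)
  have T: "T \<in> psd_mats p" unfolding T_def D_def
    using psd_mats_congruence[OF mat_diag_psd, of p s "transpose_mat V" p] s0 orth_groupD(1)[OF V]
    by simp
  have "rdiag n p (\<lambda>_. 1) * D = rdiag n p s"
    unfolding D_def rdiag_square rdiag_mult by (rule rdiag_cong) simp
  then have ED: "rdiag n p (\<lambda>_. 1) * (D * Z) = rdiag n p s * Z" if "dim_row Z = p" for Z
    using that by (simp flip: mult_assoc_dim)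
  have GT: "G * T = X" unfolding G_def T_def X by (simp add: mult_assoc_dim ED)
  obtain Q T' where Q: "Q \<in> stiefel n p" and T': "T' \<in> psd_mats p"
    and XQ: "X = Q * T" and YQ: "Y = Q * T'"
    using common_polar_factor[OF pn G T Y] YX mid unfolding GT by blast
  note [simp] = stiefelD(2-5)[OF Q] psd_matsD(2-4)[OF T'] psd_matsD(2,3)[OF T]
  define K where "K = transpose_mat U * Q * V"
  have K: "K \<in> stiefel n p" unfolding K_def
    using stiefel_mult[OF stiefel_mult[of "transpose_mat U" n n Q p], of V p] V Q
      orth_group_transpose[OF U] by (simp add: stiefel_square)
  have "K * D = transpose_mat U * (Q * T) * V"
    unfolding K_def T_def by (simp add: mult_assoc_dim right_mult_one_mat')
  also have "\<dots> = rdiag n p s"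
    unfolding XQ[symmetric] X by (simp add: mult_assoc_dim right_mult_one_mat')
  finally have KD: "K * mat_diag p s = rdiag n p s" by (simp add: D_def)
  obtain R where R: "R \<in> stiefel (n - k) (p - k)" and KR: "K = block_id k R"
    using stiefel_block_form[OF K kp pn _ KD] spos by (metis less_irrefl)
  note form = mat_diag_block_form[OF R, folded KR]
  note [simp] = stiefelD(2-5)[OF K]
  \<comment> \<open>Chosen so that \<open>U * (P * K) * transpose_mat V\<close> is
    \<open>Y\<close>.\<close>
  define P where "P = transpose_mat (V * transpose_mat K) * T' * (V * transpose_mat K)"
  have VK: "V * transpose_mat K \<in> carrier_mat p n" by (rule carrier_matI) simp_all
  have P: "P \<in> psd_mats n" unfolding P_def by (rule psd_mats_congruence[OF T' VK])
  note [simp] = psd_matsD(2,3)[OF P]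
  let ?M = "P - mat_diag n s"
  have S: "mat_diag n s \<in> block_pd_mats n k" by (rule mat_diag_block_pd[of k n s, OF kn spos szero])
  have PE: "P = K * (transpose_mat V * (T' * (V * transpose_mat K)))"
    unfolding P_def by (simp add: mult_assoc_dim transpose_mult_dim)
  have PK: "P * K = K * (transpose_mat V * (T' * V))"
    unfolding PE by (simp add: mult_assoc_dim right_mult_one_mat')
  have PKK: "P * (K * transpose_mat K) = P"
    unfolding PE by (simp add: mult_assoc_dim)
  have "mat_trace P = mat_trace T'"
  proof -
    have "mat_trace P = mat_trace (transpose_mat V * (T' * (V * transpose_mat K)) * K)"
      unfolding PE by (rule mat_trace_mult_comm) simp_all
    also have "\<dots> = mat_trace (transpose_mat V * T' * V)"
      by (simp add: mult_assoc_dim right_mult_one_mat')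
    also have "\<dots> = mat_trace T'"
      using mat_trace_orth_conj[OF orth_group_transpose[OF V] psd_matsD(1)[OF T']] by simp
    finally show ?thesis .
  qed
  moreover have "mat_trace T' = mat_trace T"
    using YX nuclear_norm_polar[OF Q T] nuclear_norm_polar[OF Q T'] XQ YQ by simp
  moreover have "mat_trace T = mat_trace (mat_diag n s)"
  proof -
    have "mat_trace T = mat_trace D" unfolding T_def
      by (rule mat_trace_orth_conj[OF V]) (rule carrier_matI, simp_all)
    also have "\<dots> = mat_trace (mat_diag n s)"
      unfolding D_def mat_trace_mat_diag using pn kp szero
      by (intro sum.mono_neutral_left) auto
    finally show ?thesis .
  qed
  ultimately have tr: "mat_trace ?M = 0" by (simp add: mat_trace_minus)
  have MK: "?M * block_id k (R * transpose_mat R) = ?M"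
    unfolding form(3) by (simp add: minus_mult_distrib_dim PKK form(4))
  have "U * (P * K) * transpose_mat V = Y"
    unfolding PK unfolding K_def YQ by (simp add: mult_assoc_dim)
  moreover have "U * (mat_diag n s * K) * transpose_mat V = X"
    unfolding form(2) X ..
  ultimately have "Y - X = U * ?M * block_id k R * transpose_mat V"
    unfolding KR[symmetric]
    by (simp add: mult_assoc_dim minus_mult_distrib_dim mult_minus_distrib_dim)
  then show ?thesis unfolding W_set_def using P S tr R MK by blast
qed

text \<open>Apply \<open>W_set_of_segment\<close> to the degenerate segment with
  \<open>Y = X\<close>.\<close>

lemma zero_in_W_set: "0\<^sub>m n p \<in> W_set n p k U V"
proof -
  have "(1 / 2) \<cdot>\<^sub>m X + (1 / 2) \<cdot>\<^sub>m X = X" by (intro eq_matI) auto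
  then have "X - X \<in> W_set n p k U V" by (intro W_set_of_segment carrier_matI) simp_all
  moreover have "X - X = 0\<^sub>m n p" by (intro eq_matI) auto
  ultimately show ?thesis by simp
qed

end

section \<open>The equivalence\<close>

lemma svd_of_singular_values:
  assumes "p \<le> n" "X \<in> carrier_mat n p" "U \<in> orth_group n" "V \<in> orth_group p"
    and X: "X = U * rect_diag n p (singular_values X) * transpose_mat V"
  obtains s where "svd n p (mat_rank X) U V X s"
proof -
  note sv = singular_values_properties[OF assms(2)]
  obtain k where k: "k \<le> p" "\<And>i. i < k \<Longrightarrow> singular_values X ! i > 0"
    "\<And>i. k \<le> i \<Longrightarrow> i < p \<Longrightarrow> singular_values X ! i = 0"
    using nonincreasing_positive_prefix[OF sv(3,2)] sv(1) by metis
  \<comment> \<open>Cut off at \<open>p\<close>, since list indexing past the end is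
    unspecified.\<close>
  define s where "s = (\<lambda>i. if i < p then singular_values X ! i else 0)"
  have s: "\<And>i. i < k \<Longrightarrow> s i > 0" "\<And>i. k \<le> i \<Longrightarrow> s i = 0"
    using k by (auto simp: s_def)
  have "rect_diag n p (singular_values X) = rdiag n p s"
    unfolding rect_diag_def rdiag_def by (intro eq_matI) (auto simp: s_def)
  then have Xs: "X = U * rdiag n p s * transpose_mat V" using X by simp
  have "vec_space.rank n X = k"
    unfolding Xs using rank_svd[OF assms(3,4) k(1) assms(1), of s] s by (metis less_irrefl)
  then have "mat_rank X = k"
    unfolding mat_rank_def using assms(2) by (simp only: carrier_matD)
  then have "svd n p (mat_rank X) U V X s"
    using k(1) assms s Xs by unfold_locales auto
  then show thesis by (rule that)
qed

theorem corollary3p6: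
  fixes n p r :: nat
    and X0 U V :: "real mat"
    and \<A> :: "real mat \<Rightarrow> 'e::real_inner"
  assumes "n \<ge> p" and "p > 0"
    and "X0 \<in> carrier_mat n p"
    and "r = mat_rank X0"
    and "U \<in> orth_group n" and "V \<in> orth_group p"
    and "X0 = U * rect_diag n p (singular_values X0) * transpose_mat V"
    and "\<exists>B :: 'e set. finite B \<and> span B = UNIV"
    and "linear_on_mats n p \<A>"
  shows "\<not> contains_proper_segment_at n p (level_set n p \<A> X0) X0
         \<longleftrightarrow> mat_kernel_on n p \<A> \<inter> W_set n p r U V = {0\<^sub>m n p}"
proof -
  obtain s where "svd n p r U V X0 s"
    using svd_of_singular_values[OF assms(1,3,5,6,7)] assms(4) by metis
  then interpret svd n p r U V X0 s .
  have add: "\<A> (A + B) = \<A> A + \<A> B" if "A \<in> carrier_mat n p" "B \<in> carrier_mat n p" for A B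
    using assms(9) that by (simp add: linear_on_mats_def)
  have smult: "\<A> (c \<cdot>\<^sub>m A) = c *\<^sub>R \<A> A" if "A \<in> carrier_mat n p" for c A
    using assms(9) that by (simp add: linear_on_mats_def)
  have "\<A> (0\<^sub>m n p) = 0" using smult[of "0\<^sub>m n p" 0] by simp
  then have zero: "0\<^sub>m n p \<in> mat_kernel_on n p \<A> \<inter> W_set n p r U V"
    using zero_in_W_set by (simp add: mat_kernel_on_def)
  \<comment> \<open>As the intersection always contains zero, the theorem is the negation of this
    equivalence.\<close>
  have "contains_proper_segment_at n p (level_set n p \<A> X0) X0 \<longleftrightarrow>
      (\<exists>H \<in> mat_kernel_on n p \<A> \<inter> W_set n p r U V. H \<noteq> 0\<^sub>m n p)"
  proof
    assume "contains_proper_segment_at n p (level_set n p \<A> X0) X0"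
    then obtain P Q where P: "P \<in> carrier_mat n p" and Q: "Q \<in> carrier_mat n p"
      and sub: "mat_segment P Q \<subseteq> level_set n p \<A> X0" and "X0 \<in> mat_segment P Q"
      and ne: "mat_segment P Q \<noteq> {X0}"
      unfolding contains_proper_segment_at_def by blast
    then obtain t where t: "0 \<le> t" "t \<le> 1" and Xt: "X0 = (1 - t) \<cdot>\<^sub>m P + t \<cdot>\<^sub>m Q"
      unfolding mat_segment_def by blast
    note [simp] = carrier_matD[OF P] carrier_matD[OF Q]
    obtain u where u: "0 \<le> u" "u \<le> 1" and "(1 - u) \<cdot>\<^sub>m P + u \<cdot>\<^sub>m Q \<noteq> X0"
      using ne \<open>X0 \<in> mat_segment P Q\<close> unfolding mat_segment_def by blast
    define Y where "Y = (1 - u) \<cdot>\<^sub>m P + u \<cdot>\<^sub>m Q"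
    have Y: "Y \<in> carrier_mat n p" "Y \<noteq> X0"
      unfolding Y_def by (rule carrier_matI, simp_all) fact
    \<comment> \<open>The parameter of the midpoint of \<open>X0\<close> and \<open>Y\<close>, which
      again lies on the segment from \<open>P\<close> to \<open>Q\<close>.\<close>
    define w where "w = (t + u) / 2"
    have "(1 / 2) \<cdot>\<^sub>m X0 + (1 / 2) \<cdot>\<^sub>m Y = (1 - w) \<cdot>\<^sub>m P + w \<cdot>\<^sub>m Q"
      unfolding Xt Y_def w_def by (intro eq_matI) (auto simp: field_simps)
    moreover have "0 \<le> w" "w \<le> 1" using t u by (auto simp: w_def)
    ultimately have "(1 / 2) \<cdot>\<^sub>m X0 + (1 / 2) \<cdot>\<^sub>m Y \<in> level_set n p \<A> X0"
      using sub unfolding mat_segment_def by auto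
    moreover have YL: "Y \<in> level_set n p \<A> X0"
      using sub u unfolding mat_segment_def Y_def by auto
    ultimately have W: "Y - X0 \<in> W_set n p r U V"
      using Y(1) by (intro W_set_of_segment) (auto simp: level_set_def)
    have c: "Y - X0 \<in> carrier_mat n p" by (rule carrier_matI) (use Y in simp_all)
    have Ye: "X0 + (Y - X0) = Y" using Y(1) by (intro eq_matI) auto
    have "\<A> Y = \<A> X0 + \<A> (Y - X0)" using add[OF assms(3) c] unfolding Ye .
    then have "\<A> (Y - X0) = 0" using YL by (simp add: level_set_def)
    then have "Y - X0 \<in> mat_kernel_on n p \<A> \<inter> W_set n p r U V"
      using W c by (simp add: mat_kernel_on_def)
    moreover have "Y - X0 \<noteq> 0\<^sub>m n p"
    proof
      assume "Y - X0 = 0\<^sub>m n p"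
      then have "Y = X0 + 0\<^sub>m n p" using Ye by simp
      then show False using Y(2) right_add_zero_mat[OF assms(3)] by simp
    qed
    ultimately show "\<exists>H \<in> mat_kernel_on n p \<A> \<inter> W_set n p r U V. H \<noteq> 0\<^sub>m n p" by blast
  next
    assume "\<exists>H \<in> mat_kernel_on n p \<A> \<inter> W_set n p r U V. H \<noteq> 0\<^sub>m n p"
    then obtain H where H: "H \<in> carrier_mat n p" "\<A> H = 0" "H \<in> W_set n p r U V" "H \<noteq> 0\<^sub>m n p"
      by (auto simp: mat_kernel_on_def)
    note [simp] = carrier_matD[OF H(1)]
    obtain e where e: "e > 0"
      "\<And>t. 0 \<le> t \<Longrightarrow> t \<le> e \<Longrightarrow> nuclear_norm (X0 + t \<cdot>\<^sub>m H) = nuclear_norm X0"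
      using W_set_direction[OF H(3)] by blast
    let ?Y = "X0 + e \<cdot>\<^sub>m H"
    have Y: "?Y \<in> carrier_mat n p" by (rule carrier_matI) simp_all
    \<comment> \<open>Parameters in the unit interval become step sizes between 0 and
      \<open>e\<close> along \<open>H\<close>.\<close>
    have pt: "(1 - t) \<cdot>\<^sub>m X0 + t \<cdot>\<^sub>m ?Y = X0 + (t * e) \<cdot>\<^sub>m H" for t
      by (intro eq_matI) (auto simp: algebra_simps)
    have "X0 + (t * e) \<cdot>\<^sub>m H \<in> level_set n p \<A> X0" if "0 \<le> t" "t \<le> 1" for t
    proof -
      have "t * e \<le> e" using that e(1) by simp
      moreover have "\<A> (X0 + (t * e) \<cdot>\<^sub>m H) = \<A> X0"
        using add[OF assms(3), of "(t * e) \<cdot>\<^sub>m H"] smult[OF H(1)] H(1,2) by simp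
      moreover have "X0 + (t * e) \<cdot>\<^sub>m H \<in> carrier_mat n p" by (rule carrier_matI) simp_all
      ultimately show ?thesis using e that by (simp add: level_set_def)
    qed
    then have "mat_segment X0 ?Y \<subseteq> level_set n p \<A> X0"
      unfolding mat_segment_def pt by blast
    moreover have "X0 + (0 * e) \<cdot>\<^sub>m H = X0" by (intro eq_matI) auto
    then have "X0 \<in> mat_segment X0 ?Y"
      unfolding mat_segment_def pt by (intro CollectI exI[of _ 0]) simp
    moreover have "?Y \<in> mat_segment X0 ?Y"
      unfolding mat_segment_def pt by (intro CollectI exI[of _ 1]) simp
    moreover have "?Y \<noteq> X0"
    proof
      assume eq: "?Y = X0"
      have "H $$ (i, j) = 0" if "i < n" "j < p" for i j
        using arg_cong[OF eq, of "\<lambda>M. M $$ (i, j)"] that e(1) by simp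
      then have "H = 0\<^sub>m n p" by (intro eq_matI) auto
      then show False using H(4) by simp
    qed
    ultimately have "mat_segment X0 ?Y \<subseteq> level_set n p \<A> X0 \<and> X0 \<in> mat_segment X0 ?Y \<and>
        mat_segment X0 ?Y \<noteq> {X0}"
      by (metis singletonD)
    then show "contains_proper_segment_at n p (level_set n p \<A> X0) X0"
      unfolding contains_proper_segment_at_def using assms(3) Y by metis
  qed
  then show ?thesis using zero by blast
qed

end
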